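(* Let $\varphi:D\to D$ be an analytic self-map of $D$, let $g\in H(D)$, and let $0<\beta<\infty$. Let $C_\varphi U_g$ be the operator $(C_\varphi U_g f)(z)=\int_0^{\varphi(z)} f(\xi)g'(\xi)\,d\xi$. (i) If $0<\alpha<1$, then $C_\varphi U_g:\mathcal{Z}^\alpha\to\mathcal{Z}^\beta$ is a bounded operator if and only if $(g'\circ\varphi)\varphi''+(g''\circ\varphi)(\varphi')^2\in H^\infty_{v_\beta}$ and $(g'\circ\varphi)(\varphi')^2\in H^\infty_{v_\beta}$. (ii) If $\alpha=1$, then $C_\varphi U_g:\mathcal{Z}^\alpha\to\mathcal{Z}^\beta$ is a bounded operator if and only if $(g'\circ\varphi)\varphi''+(g''\circ\varphi)(\varphi')^2\in H^\infty_{v_\beta}$ and $$\sup_{n\ge 0}\log(n+2)\,\|(g'\circ\varphi)(\varphi')^2\varphi^n\|_{v_\beta}\asymp\sup_{z\in D}(1-|z|^2)^\beta\log\Big(\frac{2}{1-|\varphi(z)|^2}\Big)|g'(\varphi(z))(\varphi'(z))^2|<\infty.$$ (iii) If $1<\alpha<2$, then $C_\varphi U_g:\mathcal{Z}^\alpha\to\mathcal{Z}^\beta$ is a bounded operator if and only if $(g'\circ\varphi)\varphi''+(g''\circ\varphi)(\varphi')^2\in H^\infty_{v_\beta}$ and $$\sup_{n\ge 0}(n+1)^{\alpha-1}\|(g'\circ\varphi)(\varphi')^2\varphi^n\|_{v_\beta}\asymp\sup_{z\in D}\frac{(1-|z|^2)^\beta}{(1-|\varphi(z)|^2)^{\alpha-1}}|g'(\varphi(z))(\varphi'(z))^2|<\infty.$$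 (iv) If $\alpha=2$, then $C_\varphi U_g:\mathcal{Z}^\alpha\to\mathcal{Z}^\beta$ is a bounded operator if and only if $$\sup_{n\ge 0}(n+1)\|(g'\circ\varphi)(\varphi')^2\varphi^n\|_{v_\beta}\asymp\sup_{z\in D}\frac{(1-|z|^2)^\beta}{1-|\varphi(z)|^2}|g'(\varphi(z))(\varphi'(z))^2|<\infty$$ and $$\sup_{n\ge 0}\log(n+2)\,\|((g''\circ\varphi)(\varphi')^2+(g'\circ\varphi)\varphi'')\varphi^n\|_{v_\beta}\asymp\sup_{z\in D}(1-|z|^2)^\beta\log\Big(\frac{2}{1-|\varphi(z)|^2}\Big)|g''(\varphi(z))(\varphi'(z))^2+g'(\varphi(z))\varphi''(z)|<\infty.$$ (v) If $\alpha>2$, then $C_\varphi U_g:\mathcal{Z}^\alpha\to\mathcal{Z}^\beta$ is a bounded operator if and only if $$\sup_{n\ge 0}(n+1)^{\alpha-1}\|(g'\circ\varphi)(\varphi')^2\varphi^n\|_{v_\beta}\asymp\sup_{z\in D}\frac{(1-|z|^2)^\beta}{(1-|\varphi(z)|^2)^{\alpha-1}}|g'(\varphi(z))(\varphi'(z))^2|<\infty$$ and $$\sup_{n\ge 0}(n+1)^{\alpha-2}\|((g''\circ\varphi)(\varphi')^2+(g'\circ\varphi)\varphi'')\varphi^n\|_{v_\beta}\asymp\sup_{z\in D}\frac{(1-|z|^2)^\beta}{(1-|\varphi(z)|^2)^{\alpha-2}}|g''(\varphi(z))(\varphi'(z))^2+g'(\varphi(z))\varphi''(z)|<\infty.$$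
   Context: $D=\{z\in\mathbb{C}:|z|<1\}$ and $H(D)$ is the set of analytic functions on $D$. For $0<\alpha<\infty$, the Zygmund type space $\mathcal{Z}^\alpha$ is the Banach space of $f\in H(D)$ with $\sup_{z\in D}(1-|z|^2)^\alpha|f''(z)|<\infty$, normed by $\|f\|_{\mathcal{Z}^\alpha}=|f(0)|+|f'(0)|+\sup_{z\in D}(1-|z|^2)^\alpha|f''(z)|$. For $0<\beta<\infty$, $v_\beta(z)=(1-|z|^2)^\beta$, $\|h\|_{v_\beta}=\sup_{z\in D}v_\beta(z)|h(z)|$ (possibly $+\infty$) for $h\in H(D)$, and $H^\infty_{v_\beta}=\{h\in H(D):\|h\|_{v_\beta}<\infty\}$. $\varphi^n$ denotes the $n$-th power (pointwise product) of $\varphi$, with $\varphi^0=1$. $A\asymp B$ means that there are positive constants $C_1,C_2$ with $C_1A\le B\le C_2A$ (constants not depending on $g$ or $\varphi$); a condition "$A\asymp B<\infty$" means that the two quantities are comparable and finite. *)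

theory Defs
  imports "HOL-Complex_Analysis.Complex_Analysis"
begin

text \<open>
  Functions on the open unit disc are represented by total functions on the complex plane; only
  their values on the disc matter below. In particular \<open>deriv\<close> is only used at points of the disc,
  where it depends only on the values of the function there.
\<close>

abbreviation unit_disc :: "complex set" where
  "unit_disc \<equiv> ball 0 1"

definition zygmund_space :: "real \<Rightarrow> (complex \<Rightarrow> complex) set" where
  "zygmund_space \<alpha> = {f. f holomorphic_on unit_disc \<and>
     bdd_above ((\<lambda>z. (1 - (cmod z)\<^sup>2) powr \<alpha> * cmod (deriv (deriv f) z)) ` unit_disc)}"

text \<open>Only meaningful on \<open>zygmund_space \<alpha>\<close>, where the real supremum exists.\<close>

definition zygmund_norm :: "real \<Rightarrow> (complex \<Rightarrow> complex) \<Rightarrow> real" where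
  "zygmund_norm \<alpha> f = cmod (f 0) + cmod (deriv f 0) +
     (SUP z\<in>unit_disc. (1 - (cmod z)\<^sup>2) powr \<alpha> * cmod (deriv (deriv f) z))"

definition std_weight :: "real \<Rightarrow> complex \<Rightarrow> real" where
  "std_weight \<beta> z = (1 - (cmod z)\<^sup>2) powr \<beta>"

definition weighted_norm :: "real \<Rightarrow> (complex \<Rightarrow> complex) \<Rightarrow> ennreal" where
  "weighted_norm \<beta> h = (SUP z\<in>unit_disc. ennreal (std_weight \<beta> z * cmod (h z)))"

definition weighted_Hinf :: "real \<Rightarrow> (complex \<Rightarrow> complex) set" where
  "weighted_Hinf \<beta> = {h. h holomorphic_on unit_disc \<and> weighted_norm \<beta> h < \<infinity>}"

definition analytic_self_map :: "(complex \<Rightarrow> complex) \<Rightarrow> bool" where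
  "analytic_self_map \<phi> \<longleftrightarrow> \<phi> holomorphic_on unit_disc \<and> \<phi> ` unit_disc \<subseteq> unit_disc"

text \<open>
  The integral is taken along the line segment from 0; for holomorphic \<open>f\<close> and \<open>g\<close> on the disc it
  does not depend on the path inside the disc.
\<close>

definition volterra_companion ::
  "(complex \<Rightarrow> complex) \<Rightarrow> (complex \<Rightarrow> complex) \<Rightarrow> complex \<Rightarrow> complex" where
  "volterra_companion g f z = contour_integral (linepath 0 z) (\<lambda>\<xi>. f \<xi> * deriv g \<xi>)"

definition comp_volterra ::
  "(complex \<Rightarrow> complex) \<Rightarrow> (complex \<Rightarrow> complex) \<Rightarrow> (complex \<Rightarrow> complex) \<Rightarrow> complex \<Rightarrow> complex" where
  "comp_volterra \<phi> g f = volterra_companion g f \<circ> \<phi>"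

text \<open>Linearity is required on the disc only, since functions are identified when they agree there.\<close>

definition bounded_zygmund_operator ::
  "real \<Rightarrow> real \<Rightarrow> ((complex \<Rightarrow> complex) \<Rightarrow> complex \<Rightarrow> complex) \<Rightarrow> bool" where
  "bounded_zygmund_operator \<alpha> \<beta> T \<longleftrightarrow>
     (\<forall>f\<in>zygmund_space \<alpha>. T f \<in> zygmund_space \<beta>) \<and>
     (\<forall>f\<in>zygmund_space \<alpha>. \<forall>h\<in>zygmund_space \<alpha>. \<forall>a b. \<forall>z\<in>unit_disc.
        T (\<lambda>w. a * f w + b * h w) z = a * T f z + b * T h z) \<and>
     (\<exists>C. \<forall>f\<in>zygmund_space \<alpha>. zygmund_norm \<beta> (T f) \<le> C * zygmund_norm \<alpha> f)"

text \<open>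
  The coefficients of \<open>f \<circ> \<phi>\<close> and of \<open>deriv f \<circ> \<phi>\<close> in the second derivative of
  \<open>comp_volterra \<phi> g f\<close>.
\<close>

definition coeff0 :: "(complex \<Rightarrow> complex) \<Rightarrow> (complex \<Rightarrow> complex) \<Rightarrow> complex \<Rightarrow> complex" where
  "coeff0 \<phi> g z =
     deriv g (\<phi> z) * deriv (deriv \<phi>) z + deriv (deriv g) (\<phi> z) * (deriv \<phi> z)\<^sup>2"

definition coeff1 :: "(complex \<Rightarrow> complex) \<Rightarrow> (complex \<Rightarrow> complex) \<Rightarrow> complex \<Rightarrow> complex" where
  "coeff1 \<phi> g z = deriv g (\<phi> z) * (deriv \<phi> z)\<^sup>2"

text \<open>
  Two quantities are comparable and finite, with given constants. The constants are
  parameters so that they can be quantified before \<open>\<phi>\<close> and \<open>g\<close>.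
\<close>

definition comparable_finite :: "real \<Rightarrow> real \<Rightarrow> ennreal \<Rightarrow> ennreal \<Rightarrow> bool" where
  "comparable_finite C1 C2 A B \<longleftrightarrow>
     ennreal C1 * A \<le> B \<and> B \<le> ennreal C2 * A \<and> A < \<infinity> \<and> B < \<infinity>"

end

theory Submission
  imports Defs
begin

text \<open>
  Write \<open>T\<close> for \<open>comp_volterra \<phi> g\<close>. Differentiating twice gives
  \<open>(T f)'' = (f' \<circ> \<phi>) * coeff1 \<phi> g + (f \<circ> \<phi>) * coeff0 \<phi> g\<close>, so that boundedness of \<open>T\<close> is a
  question about the size of \<open>f'\<close> and \<open>f\<close> at the point \<open>\<phi> z\<close>, for \<open>f\<close> in the unit ball of the Zygmund
  space. This size is known exactly up to constants. Integrating the bound on \<open>f''\<close> along radii shows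
  that \<open>f'\<close> and \<open>f\<close> grow at most like \<open>growth_weight (\<alpha> - 1)\<close> and \<open>growth_weight (\<alpha> - 2)\<close>
  (\<open>zygmund_growth\<close>), where \<open>growth_weight s r\<close> is \<open>1\<close>, \<open>ln (2 / (1 - r\<^sup>2))\<close> or \<open>(1 - r\<^sup>2) powr (- s)\<close>
  according to the sign of \<open>s\<close>. Conversely, functions built from powers or the logarithm of
  \<open>1 - cnj a * w\<close> attain this growth at \<open>a\<close> with norms bounded independently of \<open>a\<close>; for the bound on
  \<open>f'\<close> they can be chosen to vanish at \<open>a\<close>, which separates the two terms of \<open>(T f)''\<close>
  (\<open>zygmund_derivative_test\<close>, \<open>zygmund_value_test\<close>).

  Hence, for every \<open>\<alpha> > 0\<close>, \<open>T\<close> is bounded if and only if \<open>coeff1 \<phi> g\<close> and \<open>coeff0 \<phi> g\<close> are bounded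
  against the weight of the target space times \<open>growth_weight (\<alpha> - 1)\<close> and \<open>growth_weight (\<alpha> - 2)\<close> at
  \<open>\<bar>\<phi> z\<bar>\<close> (\<open>comp_volterra_bounded_iff\<close>). The five cases are the possible signs of \<open>\<alpha> - 1\<close> and
  \<open>\<alpha> - 2\<close>. The characterization through the powers of \<open>\<phi>\<close> follows from an estimate for real numbers:
  the supremum of \<open>n powr s * r ^ n\<close> (of \<open>ln n * r ^ n\<close> if \<open>s = 0\<close>, with \<open>n\<close> shifted away from the
  singular values) is comparable to \<open>growth_weight s r\<close>. So those two quantities are comparable
  whether or not they are finite (\<open>moment_norm_comparable\<close>).
\<close>

section \<open>Radial growth weights\<close>

text \<open>
  Up to a constant, the integral of \<open>growth_weight (s + 1)\<close> along a radius is at most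
  \<open>growth_weight s\<close>. The
  orders \<open>s < 0\<close>, \<open>s = 0\<close> and \<open>s > 0\<close> are those of a bounded, a logarithmic and a power growth at
  the boundary; since \<open>\<alpha>\<close> enters through \<open>s = \<alpha> - 1\<close> and \<open>s = \<alpha> - 2\<close>, all ranges of \<open>\<alpha>\<close> can be
  treated at once.
\<close>

definition growth_weight :: "real \<Rightarrow> real \<Rightarrow> real" where
  "growth_weight s r =
     (if s < 0 then 1 else if s = 0 then ln (2 / (1 - r\<^sup>2)) else (1 - r\<^sup>2) powr (- s))"

text \<open>
  For \<open>s \<ge> 0\<close> the supremum over \<open>n\<close> of \<open>moment_weight s n * r ^ n\<close> is comparable to
  \<open>growth_weight s r\<close>, so that powers of \<open>\<phi>\<close> can take the place of the growth weight.
\<close>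

definition moment_weight :: "real \<Rightarrow> nat \<Rightarrow> real" where
  "moment_weight s n = (if s = 0 then ln (real n + 2) else (real n + 1) powr s)"

lemma one_minus_square_bounds:
  fixes r :: real
  assumes "0 \<le> r" "r < 1"
  shows "0 < 1 - r\<^sup>2" "1 - r\<^sup>2 \<le> 1" "1 - r \<le> 1 - r\<^sup>2" "1 - r\<^sup>2 \<le> 2 * (1 - r)"
proof -
  have "r\<^sup>2 \<le> r" using assms mult_left_mono[of r 1 r] by (simp add: power2_eq_square)
  moreover have "2 * r \<le> 1 + r\<^sup>2"
    using zero_le_power2[of "1 - r"] by (simp add: power2_eq_square algebra_simps)
  ultimately show "0 < 1 - r\<^sup>2" "1 - r\<^sup>2 \<le> 1" "1 - r \<le> 1 - r\<^sup>2" "1 - r\<^sup>2 \<le> 2 * (1 - r)"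
    using assms by auto
qed

lemma growth_weight_ge_half:
  assumes "0 \<le> r" "r < 1"
  shows "1 / 2 \<le> growth_weight s r"
proof -
  note b = one_minus_square_bounds[OF assms]
  consider "s < 0" | "s = 0" | "s > 0" by linarith
  then show ?thesis
  proof cases
    case 2
    have "ln 2 \<le> ln (2 / (1 - r\<^sup>2))" using b by (simp add: field_simps)
    then show ?thesis using 2 ln2_ge_two_thirds by (simp add: growth_weight_def)
  next
    case 3
    have "1 powr (- s) \<le> (1 - r\<^sup>2) powr (- s)" using b 3 by (intro powr_mono2') auto
    then show ?thesis using 3 by (simp add: growth_weight_def)
  qed (simp add: growth_weight_def)
qed

lemma growth_weight_pos:
  assumes "0 \<le> r" "r < 1"
  shows "0 < growth_weight s r"
  using growth_weight_ge_half[OF assms, of s] by linarith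

lemma growth_weight_mono:
  assumes "0 \<le> r" "r \<le> q" "q < 1"
  shows "growth_weight s r \<le> growth_weight s q"
proof -
  have q: "0 < 1 - q\<^sup>2" "1 - q\<^sup>2 \<le> 1 - r\<^sup>2"
    using one_minus_square_bounds[of q] assms by (auto intro: power_mono)
  then have "2 / (1 - r\<^sup>2) \<le> 2 / (1 - q\<^sup>2)" by (intro divide_left_mono) auto
  then show ?thesis
    using q by (auto simp: growth_weight_def intro!: powr_mono2')
qed

text \<open>
  In place of the integral of \<open>growth_weight (s + 1)\<close> there is an explicit primitive \<open>\<Psi>\<close> of a
  majorant \<open>\<psi>\<close>, obtained from \<open>1 - t\<^sup>2 \<ge> 1 - t\<close>. For \<open>s \<ge> 0\<close>, where
  \<open>\<Psi>\<close> is unbounded, \<open>1 - t\<^sup>2 \<le> 2 * (1 - t)\<close> brings its increment back to \<open>growth_weight s\<close>.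
\<close>

lemma growth_weight_primitive:
  "\<exists>C \<Psi> \<psi>. 0 \<le> C \<and> (\<forall>t. 0 \<le> t \<longrightarrow> t < 1 \<longrightarrow>
      (\<Psi> has_real_derivative \<psi> t) (at t) \<and> growth_weight (s + 1) t \<le> \<psi> t \<and>
      \<Psi> t - \<Psi> 0 \<le> C * growth_weight s t)"
proof -
  have W: "growth_weight (s + 1) t \<le> (1 - t) powr (- s - 1)"
    if "0 \<le> t" "t < 1" "s > -1" for t
  proof -
    have "(1 - t\<^sup>2) powr (- (s + 1)) \<le> (1 - t) powr (- (s + 1))"
      using one_minus_square_bounds[of t] that by (intro powr_mono2') auto
    then show ?thesis using that by (simp add: growth_weight_def)
  qed
  consider "s < -1" | "s = -1" | "-1 < s" "s < 0" | "s = 0" | "s > 0" by linarith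
  then show ?thesis
  proof cases
    case 1
    then show ?thesis
      by (intro exI[of _ 1] exI[of _ "\<lambda>t. t"] exI[of _ "\<lambda>t. 1"])
         (auto simp: growth_weight_def)
  next
    case 2
    \<comment> \<open>The logarithm is integrable because \<open>ln x\<close> is at most \<open>2 * sqrt x\<close>.\<close>
    have *: "((\<lambda>t. - 8 * (1 - t) powr (1/2)) has_real_derivative 4 * (1 - t) powr (- 1 / 2)) (at t)"
      if "0 \<le> t" "t < 1" for t :: real
      using that by (auto intro!: derivative_eq_intros simp: powr_minus)
    have **: "ln (2 / (1 - t\<^sup>2)) \<le> 4 * (1 - t) powr (- 1 / 2)" if "0 \<le> t" "t < 1" for t :: real
    proof -
      note b = one_minus_square_bounds[OF that]
      have p: "0 < 2 / (1 - t)" using that by simp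
      have "ln (2 / (1 - t\<^sup>2)) \<le> ln (2 / (1 - t))"
        using b that by (intro iffD2[OF ln_le_cancel_iff] divide_left_mono) auto
      also have "\<dots> \<le> 2 * (2 / (1 - t)) powr (1 / 2)"
        using ln_powr_bound[of "2 / (1 - t)" "1 / 2"] that by (simp add: field_simps)
      also have "\<dots> = 2 * (2 powr (1/2) * (1 - t) powr (- 1 / 2))"
        using that by (simp add: powr_divide powr_minus field_simps)
      also have "\<dots> \<le> 2 * (2 * (1 - t) powr (- 1 / 2))"
        by (intro mult_left_mono mult_right_mono) (auto simp: powr_half_sqrt real_le_lsqrt)
      finally show ?thesis by simp
    qed
    have "- 8 * (1 - t) powr (1/2) - (- 8 * (1 - 0) powr (1/2)) \<le> 8 * growth_weight s t" for t :: real
      using 2 by (simp add: growth_weight_def)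
    then show ?thesis using 2 * **
      by (intro exI[of _ 8] exI[of _ "\<lambda>t. - 8 * (1 - t) powr (1/2)"]
          exI[of _ "\<lambda>t. 4 * (1 - t) powr (- 1 / 2)"]) (auto simp: growth_weight_def)
  next
    case 3
    have "((\<lambda>t. (1 - t) powr (- s) / s) has_real_derivative (1 - t) powr (- s - 1)) (at t)"
      if "0 \<le> t" "t < 1" for t :: real
      using that 3 by (auto intro!: derivative_eq_intros)
    moreover have "(1 - t) powr (- s) / s - (1 - 0) powr (- s) / s \<le> (- 1 / s) * growth_weight s t"
      if "0 \<le> t" "t < 1" for t :: real
      using that 3 by (simp add: growth_weight_def divide_nonneg_neg)
    ultimately show ?thesis using 3 W
      by (intro exI[of _ "- 1 / s"] exI[of _ "\<lambda>t. (1 - t) powr (- s) / s"]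
          exI[of _ "\<lambda>t. (1 - t) powr (- s - 1)"]) auto
  next
    case 4
    have "((\<lambda>t. - ln (1 - t)) has_real_derivative (1 - t) powr (- s - 1)) (at t)"
      if "0 \<le> t" "t < 1" for t :: real
      using that 4 by (auto intro!: derivative_eq_intros simp: powr_minus field_simps)
    moreover have "- ln (1 - t) - (- ln (1 - 0)) \<le> 1 * growth_weight s t"
      if "0 \<le> t" "t < 1" for t :: real
    proof -
      have "- ln (1 - t) = ln (1 / (1 - t))" using that by (simp add: ln_div)
      also have "\<dots> \<le> ln (2 / (1 - t\<^sup>2))"
        using one_minus_square_bounds[OF that] that
        by (intro iffD2[OF ln_le_cancel_iff]) (auto simp: field_simps)
      finally show ?thesis using 4 by (simp add: growth_weight_def)
    qed
    ultimately show ?thesis using 4 W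
      by (intro exI[of _ 1] exI[of _ "\<lambda>t. - ln (1 - t)"] 
          exI[of _ "\<lambda>t. (1 - t) powr (- s - 1)"]) auto
  next
    case 5
    have "((\<lambda>t. (1 - t) powr (- s) / s) has_real_derivative (1 - t) powr (- s - 1)) (at t)"
      if "0 \<le> t" "t < 1" for t :: real
      using that 5 by (auto intro!: derivative_eq_intros)
    moreover have "(1 - t) powr (- s) / s - (1 - 0) powr (- s) / s \<le> (2 powr s / s) * growth_weight s t"
      if "0 \<le> t" "t < 1" for t :: real
    proof -
      have "(2 * (1 - t)) powr (- s) \<le> (1 - t\<^sup>2) powr (- s)"
        using one_minus_square_bounds[OF that] that 5 by (intro powr_mono2') auto
      then have "2 powr s * (2 powr (- s) * (1 - t) powr (- s)) \<le> 2 powr s * growth_weight s t"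
        using 5 that by (simp add: growth_weight_def powr_mult del: mult_minus_right right_diff_distrib_numeral)
      moreover have "2 powr s * (2 powr (- s) * (1 - t) powr (- s)) = (1 - t) powr (- s)"
        by (simp add: mult.assoc[symmetric] powr_add[symmetric])
      ultimately have "(1 - t) powr (- s) \<le> 2 powr s * growth_weight s t" by simp
      then have "(1 - t) powr (- s) - 1 \<le> 2 powr s * growth_weight s t" by linarith
      from divide_right_mono[OF this, of s] show ?thesis
        using 5 by (simp add: diff_divide_distrib)
    qed
    ultimately show ?thesis using 5 W
      by (intro exI[of _ "2 powr s / s"] exI[of _ "\<lambda>t. (1 - t) powr (- s) / s"]
          exI[of _ "\<lambda>t. (1 - t) powr (- s - 1)"]) auto
  qed
qed

lemma moment_weight_nonneg: "0 \<le> moment_weight s n"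
  by (simp add: moment_weight_def)

text \<open>
  Put \<open>u = 1 - r\<close> and \<open>y = n * u\<close>. Then \<open>r ^ n \<le> exp (- y)\<close>, and \<open>n + 1\<close> is at most \<open>(1 + y) / u\<close>, so
  the powers of \<open>1 + y\<close> are swallowed by \<open>exp (- y)\<close> and what remains is the power of \<open>1 / u\<close>. In
  the logarithmic case \<open>ln (n + 2)\<close> splits as \<open>ln ((n + 2) * u) + ln (1 / u)\<close>, where the first
  summand is at most \<open>1 + y\<close>.
\<close>

lemma moment_le_growth_weight:
  assumes "0 \<le> s"
  shows "\<exists>c>0. \<forall>r n. 0 \<le> r \<longrightarrow> r < 1 \<longrightarrow> c * (moment_weight s n * r ^ n) \<le> growth_weight s r"
proof -
  have pow: "r ^ n \<le> exp (- (real n * (1 - r)))" if "0 \<le> r" "r < 1" for r :: real and n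
  proof -
    have "r ^ n \<le> exp (- (1 - r)) ^ n"
      using exp_ge_add_one_self[of "- (1 - r)"] that by (intro power_mono) auto
    then show ?thesis by (simp add: exp_of_nat_mult[symmetric] algebra_simps)
  qed
  show ?thesis
  proof (cases "s = 0")
    case True
    have "(1 / 3) * (moment_weight s n * r ^ n) \<le> growth_weight s r"
      if r: "0 \<le> r" "r < 1" for r n
    proof -
      let ?u = "1 - r" and ?e = "exp (- (real n * (1 - r)))"
      note b = one_minus_square_bounds[OF r]
      have u: "0 < ?u" "?u \<le> 1" using r by auto
      have e1: "?e \<le> 1" using u by simp
      have "real n * ?u + 1 \<le> exp (real n * ?u)"
        using exp_ge_add_one_self[of "real n * ?u"] by linarith
      then have e2: "(real n * ?u + 1) * ?e \<le> 1"
        using mult_right_mono[of "real n * ?u + 1" "exp (real n * ?u)" ?e]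
        by (simp add: exp_add[symmetric])
      have lu: "ln (1 / ?u) \<le> growth_weight s r"
      proof -
        have "ln (1 / ?u) \<le> ln (2 / (1 - r\<^sup>2))"
          using b u by (intro iffD2[OF ln_le_cancel_iff]) (auto simp: field_simps)
        then show ?thesis using True by (simp add: growth_weight_def)
      qed
      have "moment_weight s n = ln ((real n + 2) * ?u * (1 / ?u))"
        using True u by (simp add: moment_weight_def)
      also have "\<dots> = ln ((real n + 2) * ?u) + ln (1 / ?u)"
        by (intro ln_mult_pos) (use u in auto)
      also have "\<dots> \<le> (real n * ?u + 1) + ln (1 / ?u)"
      proof -
        have "ln ((real n + 2) * ?u) \<le> (real n + 2) * ?u - 1"
          using u by (intro ln_le_minus_one) auto
        also have "\<dots> \<le> real n * ?u + 1" using u by (simp add: algebra_simps)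
        finally show ?thesis by simp
      qed
      finally have m: "moment_weight s n \<le> (real n * ?u + 1) + ln (1 / ?u)" .
      have "moment_weight s n * r ^ n \<le> moment_weight s n * ?e"
        using pow[OF r] by (intro mult_left_mono moment_weight_nonneg)
      also have "\<dots> \<le> ((real n * ?u + 1) + ln (1 / ?u)) * ?e"
        using m by (intro mult_right_mono) auto
      also have "\<dots> = (real n * ?u + 1) * ?e + ln (1 / ?u) * ?e" by (simp add: algebra_simps)
      also have "\<dots> \<le> 1 + ln (1 / ?u) * 1"
        using u e1 by (intro add_mono e2 mult_left_mono) auto
      also have "\<dots> \<le> 3 * growth_weight s r"
        using lu growth_weight_ge_half[OF r, of s] by linarith
      finally show ?thesis by simp
    qed
    then show ?thesis by (intro exI[of _ "1/3"]) auto
  next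
    case False
    with assms have s: "s > 0" by simp
    let ?K = "2 powr s * s powr s * exp 1"
    have K: "?K > 0" using s by simp
    have "(1 / ?K) * (moment_weight s n * r ^ n) \<le> growth_weight s r"
      if r: "0 \<le> r" "r < 1" for r n
    proof -
      let ?y = "real n * (1 - r)"
      note b = one_minus_square_bounds[OF r]
      have y: "0 \<le> ?y" using r by simp
      have "(1 + ?y) powr s = (s * ((1 + ?y) / s)) powr s" using s by simp
      also have "\<dots> \<le> (s * exp ((1 + ?y) / s)) powr s"
      proof (rule powr_mono2)
        have "(1 + ?y) / s \<le> exp ((1 + ?y) / s)"
          using exp_ge_add_one_self[of "(1 + ?y) / s"] by linarith
        then show "s * ((1 + ?y) / s) \<le> s * exp ((1 + ?y) / s)"
          using s by (intro mult_left_mono) auto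
      qed (use s y in auto)
      also have "\<dots> = s powr s * exp (1 + ?y)"
        using s by (simp add: powr_mult exp_powr_real)
      finally have "(1 + ?y) powr s * exp (- ?y) \<le> s powr s * exp (1 + ?y) * exp (- ?y)"
        by (intro mult_right_mono) auto
      also have "\<dots> = s powr s * exp 1" by (simp add: mult.assoc exp_add[symmetric])
      finally have ye: "(1 + ?y) powr s * exp (- ?y) \<le> s powr s * exp 1" .
      have "(real n + 1) * (1 - r\<^sup>2) \<le> (real n + 1) * (2 * (1 - r))"
        using b by (intro mult_left_mono) auto
      also have "\<dots> \<le> 2 * (1 + ?y)" using r by (simp add: algebra_simps)
      finally have *: "(real n + 1) * (1 - r\<^sup>2) \<le> 2 * (1 + ?y)" .
      have "moment_weight s n * r ^ n * (1 - r\<^sup>2) powr s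
          = ((real n + 1) * (1 - r\<^sup>2)) powr s * r ^ n"
        using s b by (simp add: moment_weight_def powr_mult)
      also have "\<dots> \<le> (2 * (1 + ?y)) powr s * exp (- ?y)"
      proof (rule mult_mono[OF _ pow[OF r]])
        have "0 \<le> (real n + 1) * (1 - r\<^sup>2)" using b by (intro mult_nonneg_nonneg) auto
        then show "((real n + 1) * (1 - r\<^sup>2)) powr s \<le> (2 * (1 + ?y)) powr s"
          using s * by (intro powr_mono2) auto
      qed (use r in auto)
      also have "\<dots> = 2 powr s * ((1 + ?y) powr s * exp (- ?y))"
        by (simp only: powr_mult mult.assoc)
      also have "\<dots> \<le> ?K" using mult_left_mono[OF ye, of "2 powr s"] by (simp add: mult.assoc)
      finally have "moment_weight s n * r ^ n * (1 - r\<^sup>2) powr s \<le> ?K" .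
      then show ?thesis using s b K
        by (simp add: growth_weight_def powr_minus field_simps)
    qed
    then show ?thesis using K by (intro exI[of _ "1 / ?K"]) auto
  qed
qed

text \<open>
  Exponents of the order of \<open>1 / (1 - r)\<close> are optimal. Half of this number, rounded down, keeps \<open>r ^ n \<ge> 1 / 2\<close> by
  Bernoulli's inequality, also at \<open>r = 0\<close>, where \<open>n = 0\<close>.
\<close>

lemma growth_weight_le_moment:
  assumes "0 \<le> s"
  shows "\<exists>c>0. \<forall>r. 0 \<le> r \<longrightarrow> r < 1 \<longrightarrow> (\<exists>n. growth_weight s r \<le> c * (moment_weight s n * r ^ n))"
proof -
  have ex: "\<exists>n. 1 / 2 \<le> r ^ n \<and> 1 / (2 * (1 - r)) \<le> real n + 1"
    if r: "0 \<le> r" "r < 1" for r :: real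
  proof -
    define x where "x = 1 / (2 * (1 - r))"
    have x: "x > 0" "x * (1 - r) = 1 / 2" using r by (auto simp: x_def)
    define n where "n = nat \<lfloor>x\<rfloor>"
    have n: "real n \<le> x" "x \<le> real n + 1" using x unfolding n_def by linarith+
    have "1 - real n * (1 - r) \<le> r ^ n"
      using Bernoulli_inequality[of "- (1 - r)" n] r by (simp add: algebra_simps)
    moreover have "real n * (1 - r) \<le> 1 / 2"
      using mult_right_mono[OF n(1), of "1 - r"] x r by simp
    ultimately show ?thesis using n unfolding x_def by (intro exI[of _ n]) linarith
  qed
  show ?thesis
  proof (cases "s = 0")
    case True
    have "\<exists>n. growth_weight s r \<le> 4 * (moment_weight s n * r ^ n)" if r: "0 \<le> r" "r < 1" for r
    proof -
      obtain n where n: "1 / 2 \<le> r ^ n" "1 / (2 * (1 - r)) \<le> real n + 1" using ex[OF r] by auto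
      note b = one_minus_square_bounds[OF r]
      let ?x = "1 / (2 * (1 - r))"
      have "2 / (1 - r\<^sup>2) \<le> 2 / (1 - r)" using b r by (intro divide_left_mono) auto
      also have "\<dots> = 4 * ?x" using r by (simp add: field_simps)
      \<comment> \<open>Squaring loses only a factor 2 under the logarithm, and turns \<open>4 * ?x\<close> into a bound by \<open>n + 2\<close>.\<close>
      also have "\<dots> \<le> (?x + 1)\<^sup>2"
        using zero_le_power2[of "?x - 1"] by (simp add: power2_eq_square algebra_simps)
      also have "\<dots> \<le> (real n + 2)\<^sup>2" using n r by (intro power_mono) auto
      finally have "ln (2 / (1 - r\<^sup>2)) \<le> ln ((real n + 2)\<^sup>2)"
        using b by (intro iffD2[OF ln_le_cancel_iff]) auto
      also have "\<dots> = 4 * (moment_weight s n * (1 / 2))"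
        using True by (simp add: ln_realpow moment_weight_def)
      also have "\<dots> \<le> 4 * (moment_weight s n * r ^ n)"
        using n by (intro mult_left_mono moment_weight_nonneg) auto
      finally show ?thesis using True by (auto simp: growth_weight_def)
    qed
    then show ?thesis by (intro exI[of _ 4]) auto
  next
    case False
    with assms have s: "s > 0" by simp
    have "\<exists>n. growth_weight s r \<le> (2 * 2 powr s) * (moment_weight s n * r ^ n)"
      if r: "0 \<le> r" "r < 1" for r
    proof -
      obtain n where n: "1 / 2 \<le> r ^ n" "1 / (2 * (1 - r)) \<le> real n + 1" using ex[OF r] by auto
      note b = one_minus_square_bounds[OF r]
      have "(1 - r\<^sup>2) powr (- s) \<le> (1 - r) powr (- s)" using b r s by (intro powr_mono2') auto
      also have "\<dots> = (2 * (1 / (2 * (1 - r)))) powr s"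
      proof -
        have "2 * (1 / (2 * (1 - r))) = inverse (1 - r)" using r by (simp add: field_simps)
        then show ?thesis using r by (simp only: powr_minus inverse_powr)
      qed
      also have "\<dots> \<le> (2 * (real n + 1)) powr s"
        using n r s by (intro powr_mono2) auto
      also have "\<dots> = (2 * 2 powr s) * (moment_weight s n * (1 / 2))"
        using s powr_mult[of 2 "real n + 1" s] by (simp add: moment_weight_def)
      also have "\<dots> \<le> (2 * 2 powr s) * (moment_weight s n * r ^ n)"
        using n by (intro mult_left_mono moment_weight_nonneg) auto
      finally show ?thesis using s by (auto simp: growth_weight_def)
    qed
    then show ?thesis by (intro exI[of _ "2 * 2 powr s"]) auto
  qed
qed

section \<open>Growth of functions in Zygmund spaces\<close>

text \<open>
  This is the mean value inequality along the radius to \<open>w\<close>: the curve \<open>F (t * w)\<close> moves no faster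
  than \<open>M * \<Psi> (t * \<bar>w\<bar>)\<close>, with \<open>\<Psi>\<close> the primitive found above. The constant depends only on \<open>s\<close>.
\<close>

lemma radial_growth:
  "\<exists>C\<ge>0. \<forall>F F' M. 0 \<le> M \<longrightarrow>
     (\<forall>w\<in>unit_disc. (F has_field_derivative F' w) (at w)) \<longrightarrow>
     (\<forall>w\<in>unit_disc. cmod (F' w) \<le> M * growth_weight (s + 1) (cmod w)) \<longrightarrow>
     (\<forall>w\<in>unit_disc. cmod (F w - F 0) \<le> C * M * growth_weight s (cmod w))"
proof -
  obtain C \<Psi> \<psi> where C: "0 \<le> C" and
    \<Psi>: "\<And>t. 0 \<le> t \<Longrightarrow> t < 1 \<Longrightarrow> (\<Psi> has_real_derivative \<psi> t) (at t)" and
    \<psi>: "\<And>t. 0 \<le> t \<Longrightarrow> t < 1 \<Longrightarrow> growth_weight (s + 1) t \<le> \<psi> t" and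
    W: "\<And>t. 0 \<le> t \<Longrightarrow> t < 1 \<Longrightarrow> \<Psi> t - \<Psi> 0 \<le> C * growth_weight s t"
    using growth_weight_primitive[of s] by metis
  have "cmod (F w - F 0) \<le> C * M * growth_weight s (cmod w)"
    if M: "0 \<le> M" and F: "\<forall>w\<in>unit_disc. (F has_field_derivative F' w) (at w)"
      and F': "\<forall>w\<in>unit_disc. cmod (F' w) \<le> M * growth_weight (s + 1) (cmod w)"
      and w: "w \<in> unit_disc" for F F' M w
  proof -
    let ?r = "cmod w"
    have r: "?r < 1" using w by simp
    have tr: "0 \<le> t * ?r" "t * ?r < 1" if "0 \<le> t" "t \<le> 1" for t :: real
      using that r mult_right_mono[of t 1 ?r] by auto
    have in_disc: "of_real t * w \<in> unit_disc" if "0 \<le> t" "t \<le> 1" for t :: real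
      using tr[OF that] that by (simp add: norm_mult)
    have dF: "((\<lambda>t. F (of_real t * w)) has_vector_derivative w * F' (of_real t * w)) (at t)"
      if "0 \<le> t" "t \<le> 1" for t :: real
    proof -
      have "((\<lambda>t. of_real t * w) has_vector_derivative 1 * w) (at t)"
        by (intro has_vector_derivative_mult_left)
           (simp add: has_vector_derivative_def scaleR_conv_of_real bounded_linear_imp_has_derivative
             bounded_linear_of_real)
      from field_vector_diff_chain_at[OF this bspec[OF F in_disc[OF that]]]
      show ?thesis by (simp add: o_def)
    qed
    have dP: "((\<lambda>t. M * \<Psi> (t * ?r)) has_vector_derivative M * (?r * \<psi> (t * ?r))) (at t)"
      if "0 \<le> t" "t \<le> 1" for t :: real
      unfolding has_real_derivative_iff_has_vector_derivative[symmetric]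
      by (rule derivative_eq_intros DERIV_chain2[where g = "\<lambda>t. t * ?r"] \<Psi> tr that refl | simp)+
    have "norm (F (of_real 1 * w) - F (of_real 0 * w)) \<le> M * \<Psi> (1 * ?r) - M * \<Psi> (0 * ?r)"
    proof (rule differentiable_bound_general[OF zero_less_one])
      show "continuous_on {0..1} (\<lambda>t. F (of_real t * w))"
        by (rule continuous_at_imp_continuous_on) (use dF has_vector_derivative_continuous in fastforce)
      show "continuous_on {0..1} (\<lambda>t. M * \<Psi> (t * ?r))"
        by (rule continuous_at_imp_continuous_on) (use dP has_vector_derivative_continuous in fastforce)
    next
      fix t :: real assume t: "0 < t" "t < 1"
      then have t': "0 \<le> t" "t \<le> 1" by auto
      show "((\<lambda>t. F (of_real t * w)) has_vector_derivative w * F' (of_real t * w)) (at t)"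
        by (rule dF[OF t'])
      show "((\<lambda>t. M * \<Psi> (t * ?r)) has_vector_derivative M * (?r * \<psi> (t * ?r))) (at t)"
        by (rule dP[OF t'])
      have "cmod (F' (of_real t * w)) \<le> M * growth_weight (s + 1) (cmod (of_real t * w))"
        using F' in_disc[OF t'] by blast
      also have "\<dots> \<le> M * \<psi> (t * ?r)"
        using \<psi>[OF tr[OF t']] M t by (intro mult_left_mono) (auto simp: norm_mult)
      finally have "?r * cmod (F' (of_real t * w)) \<le> ?r * (M * \<psi> (t * ?r))"
        by (intro mult_left_mono) auto
      then show "cmod (w * F' (of_real t * w)) \<le> M * (?r * \<psi> (t * ?r))"
        by (simp add: norm_mult mult_ac)
    qed
    also have "\<dots> \<le> M * (C * growth_weight s ?r)"
      using mult_left_mono[OF W[of ?r] M] r by (simp add: right_diff_distrib)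
    finally show ?thesis by (simp add: mult_ac)
  qed
  then show ?thesis using C by blast
qed

lemma holomorphic_disc_DERIV:
  assumes "f holomorphic_on unit_disc" "z \<in> unit_disc"
  shows "(f has_field_derivative deriv f z) (at z)"
  using assms holomorphic_derivI open_ball by blast

lemma holomorphic_discI:
  assumes "\<And>z. z \<in> unit_disc \<Longrightarrow> (f has_field_derivative f' z) (at z)"
  shows "f holomorphic_on unit_disc"
  unfolding holomorphic_on_open[OF open_ball] using assms by blast

text \<open>
  An explicit derivative \<open>f1\<close> agrees with \<open>deriv f\<close> on the disc only, so it can replace it under a
  second \<open>deriv\<close> because the disc is open.
\<close>

lemma disc_second_deriv:
  assumes "\<And>z. z \<in> unit_disc \<Longrightarrow> (f has_field_derivative f1 z) (at z)"
    and "\<And>z. z \<in> unit_disc \<Longrightarrow> (f1 has_field_derivative f2 z) (at z)"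
    and "z \<in> unit_disc"
  shows "deriv f z = f1 z" "deriv (deriv f) z = f2 z"
proof -
  have "f1 w = deriv f w" if "w \<in> unit_disc" for w
    using DERIV_imp_deriv[OF assms(1)[OF that]] by simp
  then have "(deriv f has_field_derivative f2 z) (at z)"
    by (intro DERIV_cong_ev[THEN iffD1, OF refl _ refl assms(2)[OF assms(3)]]
          eventually_mono[OF eventually_nhds_in_open[of unit_disc]])
       (use assms(3) in auto)
  then show "deriv (deriv f) z = f2 z" by (rule DERIV_imp_deriv)
qed (use assms DERIV_imp_deriv in blast)

lemma zygmund_bound:
  assumes "f \<in> zygmund_space \<alpha>" "z \<in> unit_disc"
  shows "std_weight \<alpha> z * cmod (deriv (deriv f) z) \<le> zygmund_norm \<alpha> f"
proof -
  have "std_weight \<alpha> z * cmod (deriv (deriv f) z) \<le>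
    (SUP z\<in>unit_disc. (1 - (cmod z)\<^sup>2) powr \<alpha> * cmod (deriv (deriv f) z))"
    unfolding std_weight_def using assms by (intro cSUP_upper) (auto simp: zygmund_space_def)
  then show ?thesis by (simp add: zygmund_norm_def add_nonneg_nonneg add_increasing)
qed

lemma zygmund_norm_at_0:
  assumes "f \<in> zygmund_space \<alpha>"
  shows "0 \<le> zygmund_norm \<alpha> f" "cmod (f 0) \<le> zygmund_norm \<alpha> f"
    "cmod (deriv f 0) \<le> zygmund_norm \<alpha> f"
proof -
  have "std_weight \<alpha> 0 * cmod (deriv (deriv f) 0) \<le>
    (SUP z\<in>unit_disc. (1 - (cmod z)\<^sup>2) powr \<alpha> * cmod (deriv (deriv f) z))"
    unfolding std_weight_def using assms
    by (intro cSUP_upper) (auto simp: zygmund_space_def)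
  then have "0 \<le> (SUP z\<in>unit_disc. (1 - (cmod z)\<^sup>2) powr \<alpha> * cmod (deriv (deriv f) z))"
    by (simp add: std_weight_def order_trans[OF norm_ge_zero])
  then show "0 \<le> zygmund_norm \<alpha> f" "cmod (f 0) \<le> zygmund_norm \<alpha> f"
    "cmod (deriv f 0) \<le> zygmund_norm \<alpha> f"
    by (auto simp: zygmund_norm_def)
qed

lemma zygmund_memI:
  assumes f1: "\<And>z. z \<in> unit_disc \<Longrightarrow> (f has_field_derivative f1 z) (at z)"
    and f2: "\<And>z. z \<in> unit_disc \<Longrightarrow> (f1 has_field_derivative f2 z) (at z)"
    and B: "\<And>z. z \<in> unit_disc \<Longrightarrow> std_weight \<alpha> z * cmod (f2 z) \<le> B"
  shows "f \<in> zygmund_space \<alpha>" "zygmund_norm \<alpha> f \<le> cmod (f 0) + cmod (f1 0) + B"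
proof -
  note d = disc_second_deriv[OF f1 f2]
  have *: "(1 - (cmod z)\<^sup>2) powr \<alpha> * cmod (deriv (deriv f) z) \<le> B" if "z \<in> unit_disc" for z
    using B[OF that] d(2)[OF _ _ that] by (simp add: std_weight_def)
  have "f holomorphic_on unit_disc" using f1 by (rule holomorphic_discI)
  then show "f \<in> zygmund_space \<alpha>"
    using * by (auto simp: zygmund_space_def intro!: bdd_aboveI2)
  have "(SUP z\<in>unit_disc. (1 - (cmod z)\<^sup>2) powr \<alpha> * cmod (deriv (deriv f) z)) \<le> B"
    using * by (intro cSUP_least) auto
  then show "zygmund_norm \<alpha> f \<le> cmod (f 0) + cmod (f1 0) + B"
    using d(1)[of 0] by (simp add: zygmund_norm_def)
qed

text \<open>
  A function in the Zygmund space has a second derivative bounded by \<open>growth_weight \<alpha>\<close>; integrating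
  twice lowers the order to \<open>\<alpha> - 1\<close> and then to \<open>\<alpha> - 2\<close>.
\<close>

lemma zygmund_growth:
  assumes "0 < \<alpha>"
  shows "\<exists>C\<ge>0. \<forall>f\<in>zygmund_space \<alpha>. \<forall>w\<in>unit_disc.
     cmod (deriv f w) \<le> C * zygmund_norm \<alpha> f * growth_weight (\<alpha> - 1) (cmod w) \<and>
     cmod (f w) \<le> C * zygmund_norm \<alpha> f * growth_weight (\<alpha> - 2) (cmod w)"
proof -
  obtain C1 where C1: "0 \<le> C1" and g1: "\<And>F F' M w. 0 \<le> M \<Longrightarrow>
     (\<And>w. w\<in>unit_disc \<Longrightarrow> (F has_field_derivative F' w) (at w)) \<Longrightarrow>
     (\<And>w. w\<in>unit_disc \<Longrightarrow> cmod (F' w) \<le> M * growth_weight (\<alpha> - 1 + 1) (cmod w)) \<Longrightarrow>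
     w\<in>unit_disc \<Longrightarrow> cmod (F w - F 0) \<le> C1 * M * growth_weight (\<alpha> - 1) (cmod w)"
    using radial_growth[of "\<alpha> - 1"] by metis
  obtain C2 where C2: "0 \<le> C2" and g2: "\<And>F F' M w. 0 \<le> M \<Longrightarrow>
     (\<And>w. w\<in>unit_disc \<Longrightarrow> (F has_field_derivative F' w) (at w)) \<Longrightarrow>
     (\<And>w. w\<in>unit_disc \<Longrightarrow> cmod (F' w) \<le> M * growth_weight (\<alpha> - 2 + 1) (cmod w)) \<Longrightarrow>
     w\<in>unit_disc \<Longrightarrow> cmod (F w - F 0) \<le> C2 * M * growth_weight (\<alpha> - 2) (cmod w)"
    using radial_growth[of "\<alpha> - 2"] by metis
  \<comment> \<open>The value at the origin is absorbed because every growth weight is at least one half.\<close>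
  have absorb: "cmod (F w) \<le> (2 + K) * N * growth_weight s (cmod w)"
    if "cmod (F w - F 0) \<le> K * N * growth_weight s (cmod w)" "cmod (F 0) \<le> N" "w \<in> unit_disc"
    for F :: "complex \<Rightarrow> complex" and K N s w
  proof -
    have "0 \<le> N" using that(2) norm_ge_zero order_trans by blast
    then have "N * (1 / 2) \<le> N * growth_weight s (cmod w)"
      using that(3) by (intro mult_left_mono growth_weight_ge_half) auto
    then have "cmod (F 0) \<le> 2 * N * growth_weight s (cmod w)" using that(2) by linarith
    moreover have "cmod (F w) \<le> cmod (F w - F 0) + cmod (F 0)"
      by (metis diff_add_cancel norm_triangle_ineq)
    ultimately show ?thesis using that(1) by (simp add: distrib_right)
  qed
  let ?D1 = "2 + C1" and ?D2 = "2 + C2 * (2 + C1)"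
  have D: "?D1 \<le> ?D1 + ?D2" "?D2 \<le> ?D1 + ?D2" using C1 C2 by auto
  have "cmod (deriv f w) \<le> (?D1 + ?D2) * zygmund_norm \<alpha> f * growth_weight (\<alpha> - 1) (cmod w) \<and>
     cmod (f w) \<le> (?D1 + ?D2) * zygmund_norm \<alpha> f * growth_weight (\<alpha> - 2) (cmod w)"
    if f: "f \<in> zygmund_space \<alpha>" and w: "w \<in> unit_disc" for f w
  proof -
    let ?N = "zygmund_norm \<alpha> f"
    note N = zygmund_norm_at_0[OF f]
    have hol: "f holomorphic_on unit_disc" using f by (simp add: zygmund_space_def)
    then have hol': "deriv f holomorphic_on unit_disc" by (intro holomorphic_deriv) auto
    have "cmod (deriv (deriv f) w) \<le> ?N * growth_weight \<alpha> (cmod w)" if "w \<in> unit_disc" for w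
    proof -
      have "0 < 1 - (cmod w)\<^sup>2" using that one_minus_square_bounds by simp
      then show ?thesis
        using zygmund_bound[OF f that] assms
        by (simp add: std_weight_def growth_weight_def powr_minus field_simps)
    qed
    then have "cmod (deriv f w - deriv f 0) \<le> C1 * ?N * growth_weight (\<alpha> - 1) (cmod w)"
      if "w \<in> unit_disc" for w
      by (intro g1[of ?N "deriv f" "deriv (deriv f)"] N holomorphic_disc_DERIV hol') (use that in auto)
    then have d: "cmod (deriv f w) \<le> ?D1 * ?N * growth_weight (\<alpha> - 1) (cmod w)"
      if "w \<in> unit_disc" for w
      by (intro absorb N) (use that in auto)
    have "cmod (f w - f 0) \<le> C2 * (?D1 * ?N) * growth_weight (\<alpha> - 2) (cmod w)"
      by (intro g2[of "?D1 * ?N" f "deriv f"] N holomorphic_disc_DERIV hol mult_nonneg_nonneg)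
         (use w C1 d in auto)
    then have "cmod (f w) \<le> ?D2 * ?N * growth_weight (\<alpha> - 2) (cmod w)"
      by (intro absorb N) (use w in \<open>auto simp: mult.assoc\<close>)
    moreover have "D * ?N * growth_weight s (cmod w) \<le> (?D1 + ?D2) * ?N * growth_weight s (cmod w)"
      if "D \<le> ?D1 + ?D2" for D s
      using that N w growth_weight_pos[of "cmod w" s] by (intro mult_right_mono) auto
    ultimately show ?thesis using d[OF w] D order_trans by blast
  qed
  moreover have "0 \<le> ?D1 + ?D2" using C1 C2 by auto
  ultimately show ?thesis by blast
qed

section \<open>Functions of extremal growth\<close>

text \<open>
  The first estimate says that the disc automorphism \<open>(w - a) / (1 - cnj a * w)\<close> maps into the disc;
  it makes the factor \<open>w - a\<close> as good as a power of the kernel. The second lets a power of the kernel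
  absorb the weight, uniformly in \<open>a\<close>. The third keeps the kernel inside the domain of the principal
  branch of the logarithm.
\<close>

lemma disc_kernel:
  assumes a: "a \<in> unit_disc" and w: "w \<in> unit_disc"
  shows "cmod (w - a) \<le> cmod (1 - cnj a * w)"
    and "1 - (cmod w)\<^sup>2 \<le> 2 * cmod (1 - cnj a * w)"
    and "0 < Re (1 - cnj a * w)" and "0 < cmod (1 - cnj a * w)"
proof -
  have aw: "cmod (cnj a * w) \<le> cmod w" "cmod w < 1" "cmod a < 1"
    using a w mult_right_mono[of "cmod a" 1 "cmod w"] by (auto simp: norm_mult)
  have "(cmod (1 - cnj a * w))\<^sup>2 - (cmod (w - a))\<^sup>2 = (1 - (cmod a)\<^sup>2) * (1 - (cmod w)\<^sup>2)"
    unfolding cmod_power2 by (simp add: algebra_simps power2_eq_square)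
  moreover have "0 \<le> (1 - (cmod a)\<^sup>2) * (1 - (cmod w)\<^sup>2)"
    by (rule mult_nonneg_nonneg[OF less_imp_le less_imp_le,
          OF one_minus_square_bounds(1) one_minus_square_bounds(1)])
       (simp_all only: norm_ge_zero aw)
  ultimately have "(cmod (w - a))\<^sup>2 \<le> (cmod (1 - cnj a * w))\<^sup>2" by linarith
  then show "cmod (w - a) \<le> cmod (1 - cnj a * w)"
    by (rule power2_le_imp_le[OF _ norm_ge_zero])
  have "1 - cmod w \<le> cmod (1 - cnj a * w)"
    using norm_triangle_ineq2[of 1 "cnj a * w"] aw by auto
  then show "1 - (cmod w)\<^sup>2 \<le> 2 * cmod (1 - cnj a * w)"
    using one_minus_square_bounds(4)[of "cmod w"] aw by auto
  have "Re (cnj a * w) \<le> cmod (cnj a * w)" by (rule complex_Re_le_cmod)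
  then show "0 < Re (1 - cnj a * w)" using aw by simp
  then show "0 < cmod (1 - cnj a * w)" by (rule order.strict_trans2[OF _ complex_Re_le_cmod])
qed

text \<open>
  The three cases of \<open>growth_kernel\<close> below have derivatives of the same form, with this constant in
  front.
\<close>

definition kernel_coeff :: "real \<Rightarrow> real" where
  "kernel_coeff s = (if s < 0 then 0 else if s = 0 then 1 else s)"

text \<open>
  This is the function obtained from \<open>growth_weight s\<close> by replacing \<open>1 - r\<^sup>2\<close> with \<open>1 - cnj a * w\<close>: it
  is holomorphic in \<open>w\<close> and takes the value \<open>growth_weight s \<bar>a\<bar>\<close> at \<open>w = a\<close>.
\<close>

definition growth_kernel :: "real \<Rightarrow> complex \<Rightarrow> complex \<Rightarrow> complex" where
  "growth_kernel s a w =
     (if s < 0 then 1 else if s = 0 then Ln 2 - Ln (1 - cnj a * w)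
      else (1 - cnj a * w) powr of_real (- s))"

definition growth_kernel_deriv :: "real \<Rightarrow> complex \<Rightarrow> complex \<Rightarrow> complex" where
  "growth_kernel_deriv s a w = of_real (kernel_coeff s) * cnj a * (1 - cnj a * w) powr of_real (- s - 1)"

definition growth_kernel_deriv2 :: "real \<Rightarrow> complex \<Rightarrow> complex \<Rightarrow> complex" where
  "growth_kernel_deriv2 s a w = of_real (kernel_coeff s) * of_real (s + 1) * (cnj a)\<^sup>2 *
     (1 - cnj a * w) powr of_real (- s - 2)"

lemma growth_kernel_DERIV:
  assumes a: "a \<in> unit_disc" and w: "w \<in> unit_disc"
  shows "(growth_kernel s a has_field_derivative growth_kernel_deriv s a w) (at w)"
    and "(growth_kernel_deriv s a has_field_derivative growth_kernel_deriv2 s a w) (at w)"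
proof -
  let ?q = "\<lambda>w. 1 - cnj a * w"
  have q: "?q w \<notin> \<real>\<^sub>\<le>\<^sub>0"
    using disc_kernel(3)[OF a w] by (auto simp: complex_nonpos_Reals_iff)
  have dq: "(?q has_field_derivative - cnj a) (at w)"
    by (auto intro!: derivative_eq_intros)
  have dpow: "((\<lambda>w. ?q w powr r) has_field_derivative r * ?q w powr (r - 1) * (- cnj a)) (at w)" for r
    by (rule DERIV_chain2[OF has_field_derivative_powr[OF q] dq])
  consider "s < 0" | "s = 0" | "s > 0" by linarith
  then show "(growth_kernel s a has_field_derivative growth_kernel_deriv s a w) (at w)"
  proof cases
    case 1
    then show ?thesis
      by (simp add: growth_kernel_def[abs_def] growth_kernel_deriv_def kernel_coeff_def)
  next
    case 2
    have "((\<lambda>w. Ln 2 - Ln (?q w)) has_field_derivative 0 - inverse (?q w) * (- cnj a)) (at w)"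
      by (intro DERIV_diff DERIV_const DERIV_chain2[OF has_field_derivative_Ln[OF q] dq])
    moreover have "0 - inverse (?q w) * (- cnj a) = growth_kernel_deriv s a w"
      using 2 by (simp add: growth_kernel_deriv_def kernel_coeff_def powr_minus)
    ultimately show ?thesis using 2 by (simp add: growth_kernel_def[abs_def])
  next
    case 3
    have "of_real (- s) * ?q w powr (of_real (- s) - 1) * (- cnj a) = growth_kernel_deriv s a w"
      using 3 by (simp add: growth_kernel_deriv_def kernel_coeff_def)
    with dpow[of "of_real (- s)"] show ?thesis using 3 by (simp add: growth_kernel_def[abs_def])
  qed
  have "(growth_kernel_deriv s a has_field_derivative of_real (kernel_coeff s) * cnj a *
      (of_real (- s - 1) * ?q w powr (of_real (- s - 1) - 1) * (- cnj a))) (at w)"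
    unfolding growth_kernel_deriv_def[abs_def] by (intro DERIV_cmult dpow)
  moreover have "of_real (- s - 1) - (1::complex) = of_real (- s - 2)"
    "of_real (- s - 1) = - (of_real (s + 1) :: complex)" by simp_all
  moreover have alg: "c * b * (- x * y * (- b)) = c * x * b\<^sup>2 * y" for b c x y :: complex
    by (simp add: power2_eq_square mult_ac)
  ultimately show "(growth_kernel_deriv s a has_field_derivative growth_kernel_deriv2 s a w) (at w)"
    by (simp only: growth_kernel_deriv2_def alg)
qed

lemma growth_kernel_diagonal:
  assumes a: "a \<in> unit_disc"
  shows "growth_kernel s a a = of_real (growth_weight s (cmod a))"
proof -
  have b: "0 < 1 - (cmod a)\<^sup>2" using a one_minus_square_bounds by simp
  have qa: "1 - cnj a * a = of_real (1 - (cmod a)\<^sup>2)"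
    using complex_norm_square[of a] by (simp add: mult.commute)
  consider "s < 0" | "s = 0" | "s > 0" by linarith
  then show ?thesis
  proof cases
    case 2
    have "growth_kernel s a a = Ln (of_real 2) - Ln (of_real (1 - (cmod a)\<^sup>2))"
      using 2 by (simp only: growth_kernel_def qa) simp
    also have "\<dots> = of_real (ln 2 - ln (1 - (cmod a)\<^sup>2))"
      using b Ln_of_real[of "1 - (cmod a)\<^sup>2"] Ln_of_real[of 2] by simp
    also have "ln 2 - ln (1 - (cmod a)\<^sup>2) = growth_weight s (cmod a)"
      using 2 b by (simp add: growth_weight_def ln_div)
    finally show ?thesis .
  next
    case 3
    then have "growth_kernel s a a = of_real (1 - (cmod a)\<^sup>2) powr of_real (- s)"
      by (simp only: growth_kernel_def qa) simp
    also have "\<dots> = of_real ((1 - (cmod a)\<^sup>2) powr (- s))"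
      using b by (intro powr_of_real) auto
    finally show ?thesis using 3 by (simp add: growth_weight_def)
  qed (simp add: growth_kernel_def growth_weight_def)
qed

lemma growth_kernel_at_0: "cmod (growth_kernel s a 0) \<le> 1"
proof -
  have "Ln 2 = of_real (ln 2)" using Ln_of_real[of 2] by simp
  then have "cmod (Ln 2) \<le> 1" using ln_le_minus_one[of 2] by simp
  then show ?thesis by (simp add: growth_kernel_def)
qed

lemma kernel_coeff_bounds:
  "0 \<le> kernel_coeff s" "kernel_coeff s \<le> kernel_coeff s * (s + 1)" "0 \<le> kernel_coeff s * (s + 1)"
  by (auto simp: kernel_coeff_def)

lemma growth_kernel_bounds:
  fixes s :: real
  assumes a: "a \<in> unit_disc"
  defines "C \<equiv> kernel_coeff s * (s + 1)"
  shows "cmod (growth_kernel_deriv s a w) \<le> C * cmod (1 - cnj a * w) powr (- s - 1)"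
    and "cmod (growth_kernel_deriv2 s a w) \<le> C * cmod (1 - cnj a * w) powr (- s - 2)"
proof -
  let ?q = "cmod (1 - cnj a * w)"
  note c = kernel_coeff_bounds[of s]
  have a1: "cmod a \<le> 1" using a by simp
  have "kernel_coeff s * cmod a \<le> C * 1"
    unfolding C_def using c a1 by (intro mult_mono) auto
  then show "cmod (growth_kernel_deriv s a w) \<le> C * ?q powr (- s - 1)"
    using c by (simp add: growth_kernel_deriv_def norm_mult norm_powr_real_powr' mult_right_mono
        del: of_real_diff of_real_minus)
  have "cmod (growth_kernel_deriv2 s a w) = \<bar>C\<bar> * (cmod a)\<^sup>2 * ?q powr (- s - 2)"
    unfolding growth_kernel_deriv2_def C_def of_real_mult[symmetric]
    by (simp add: norm_mult norm_power norm_powr_real_powr' del: of_real_diff of_real_minus of_real_mult of_real_add)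
  also have "\<dots> \<le> \<bar>C\<bar> * 1 * ?q powr (- s - 2)"
    using a1 by (intro mult_right_mono mult_left_mono power_le_one) auto
  finally show "cmod (growth_kernel_deriv2 s a w) \<le> C * ?q powr (- s - 2)"
    using c(3) by (simp add: C_def)
qed

lemma weight_le_kernel:
  assumes "0 < \<alpha>" and a: "a \<in> unit_disc" and w: "w \<in> unit_disc"
    and y: "cmod y \<le> K * cmod (1 - cnj a * w) powr (- \<alpha>)"
  shows "std_weight \<alpha> w * cmod y \<le> K * 2 powr \<alpha>"
proof -
  let ?q = "cmod (1 - cnj a * w)"
  note k = disc_kernel[OF a w]
  have b: "0 < 1 - (cmod w)\<^sup>2" using w one_minus_square_bounds by simp
  have "std_weight \<alpha> w \<le> (2 * ?q) powr \<alpha>"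
    unfolding std_weight_def using k b assms by (intro powr_mono2) auto
  then have "std_weight \<alpha> w * cmod y \<le> (2 * ?q) powr \<alpha> * (K * ?q powr (- \<alpha>))"
    using y by (intro mult_mono') (auto simp: std_weight_def)
  also have "\<dots> = K * 2 powr \<alpha> * (?q powr \<alpha> * ?q powr (- \<alpha>))"
    by (simp only: powr_mult mult_ac)
  also have "\<dots> = K * 2 powr \<alpha>" using k(4) by (simp add: powr_minus)
  finally show ?thesis .
qed

text \<open>
  The kernel of order \<open>\<alpha> - 2\<close> shows that the bound on \<open>f\<close> in \<open>zygmund_growth\<close> is attained, up to
  a constant, at any prescribed point by functions of uniformly bounded norm.
\<close>

lemma zygmund_value_test:
  assumes "0 < \<alpha>"
  shows "\<exists>N. \<forall>a\<in>unit_disc. \<exists>f\<in>zygmund_space \<alpha>. zygmund_norm \<alpha> f \<le> N \<and>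
     f a = of_real (growth_weight (\<alpha> - 2) (cmod a))"
proof (rule exI, rule ballI)
  let ?s = "\<alpha> - 2"
  let ?C = "kernel_coeff ?s * (?s + 1)"
  fix a assume a: "a \<in> unit_disc"
  have "std_weight \<alpha> w * cmod (growth_kernel_deriv2 ?s a w) \<le> ?C * 2 powr \<alpha>" if "w \<in> unit_disc" for w
    using growth_kernel_bounds(2)[OF a, of ?s w] by (intro weight_le_kernel[OF assms a that]) simp
  note m = zygmund_memI[OF growth_kernel_DERIV[OF a] this]
  have "cmod (growth_kernel_deriv ?s a 0) \<le> ?C" using growth_kernel_bounds(1)[OF a, of ?s 0] by simp
  then have "zygmund_norm \<alpha> (growth_kernel ?s a) \<le> 1 + ?C + ?C * 2 powr \<alpha>"
    using m(2) growth_kernel_at_0[of ?s a] by linarith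
  then show "\<exists>f\<in>zygmund_space \<alpha>. zygmund_norm \<alpha> f \<le> 1 + ?C + ?C * 2 powr \<alpha> \<and>
     f a = of_real (growth_weight ?s (cmod a))"
    using m(1) growth_kernel_diagonal[OF a] by blast
qed

text \<open>
  The bound on \<open>deriv f\<close> is attained, up to a constant, by a function that moreover vanishes at the point, namely
  \<open>(w - a)\<close> times the kernel of order \<open>\<alpha> - 1\<close>. The zero makes the test see one of the two
  coefficients alone; it costs nothing because \<open>w - a\<close> is dominated by \<open>1 - cnj a * w\<close>.
\<close>

lemma zygmund_derivative_test:
  assumes "0 < \<alpha>"
  shows "\<exists>N. \<forall>a\<in>unit_disc. \<exists>f\<in>zygmund_space \<alpha>. zygmund_norm \<alpha> f \<le> N \<and>
     f a = 0 \<and> deriv f a = of_real (growth_weight (\<alpha> - 1) (cmod a))"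
proof (rule exI, rule ballI)
  let ?s = "\<alpha> - 1"
  let ?C = "kernel_coeff ?s * (?s + 1)"
  fix a assume a: "a \<in> unit_disc"
  let ?p = "growth_kernel ?s a" and ?p1 = "growth_kernel_deriv ?s a" and ?p2 = "growth_kernel_deriv2 ?s a"
  note d = growth_kernel_DERIV[OF a] and n = growth_kernel_bounds[OF a, of ?s]
  let ?f = "\<lambda>w. (w - a) * ?p w" and ?f1 = "\<lambda>w. ?p w + (w - a) * ?p1 w"
    and ?f2 = "\<lambda>w. 2 * ?p1 w + (w - a) * ?p2 w"
  have f1: "(?f has_field_derivative ?f1 w) (at w)" if "w \<in> unit_disc" for w
    using d(1)[OF that] by (auto intro!: derivative_eq_intros)
  have f2: "(?f1 has_field_derivative ?f2 w) (at w)" if "w \<in> unit_disc" for w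
    using d[OF that] by (auto intro!: derivative_eq_intros)
  have "std_weight \<alpha> w * cmod (?f2 w) \<le> 3 * ?C * 2 powr \<alpha>" if w: "w \<in> unit_disc" for w
  proof (rule weight_le_kernel[OF assms a w])
    let ?q = "cmod (1 - cnj a * w)"
    note k = disc_kernel[OF a w]
    have "cmod (?f2 w) \<le> 2 * cmod (?p1 w) + cmod (w - a) * cmod (?p2 w)"
      by (metis norm_mult norm_numeral norm_triangle_ineq)
    also have "\<dots> \<le> 2 * (?C * ?q powr (- ?s - 1)) + ?q * (?C * ?q powr (- ?s - 2))"
      using n[of w] k(1) by (intro add_mono mult_mono) auto
    also have "?q * (?C * ?q powr (- ?s - 2)) = ?C * (?q powr 1 * ?q powr (- ?s - 2))"
      using k(4) by (simp only: powr_one mult_ac)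
    also have "\<dots> = ?C * ?q powr (- \<alpha>)" by (simp only: powr_add[symmetric]) simp
    finally show "cmod (?f2 w) \<le> 3 * ?C * ?q powr (- \<alpha>)" by (simp add: mult_ac)
  qed
  note m = zygmund_memI[OF f1 f2 this]
  have p10: "cmod (?p1 0) \<le> ?C" using n(1)[of 0] by simp
  have "cmod (a * ?p 0) \<le> 1 * 1"
    unfolding norm_mult using a growth_kernel_at_0[of ?s a] by (intro mult_mono) auto
  then have "cmod (?f 0) \<le> 1" by simp
  moreover have "cmod (a * ?p1 0) \<le> 1 * ?C"
    unfolding norm_mult using a p10 by (intro mult_mono) auto
  then have "cmod (?f1 0) \<le> 1 + ?C"
    using growth_kernel_at_0[of ?s a] norm_triangle_ineq4[of "?p 0" "a * ?p1 0"] by simp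
  ultimately have N: "zygmund_norm \<alpha> ?f \<le> 1 + (1 + ?C) + 3 * ?C * 2 powr \<alpha>"
    using m(2) by linarith
  have "deriv ?f a = ?f1 a" by (rule DERIV_imp_deriv[OF f1[OF a]])
  then have "deriv ?f a = of_real (growth_weight ?s (cmod a))"
    using growth_kernel_diagonal[OF a, of ?s] by simp
  then show "\<exists>f\<in>zygmund_space \<alpha>. zygmund_norm \<alpha> f \<le> 1 + (1 + ?C) + 3 * ?C * 2 powr \<alpha> \<and>
     f a = 0 \<and> deriv f a = of_real (growth_weight ?s (cmod a))"
    by (intro bexI[of _ ?f] conjI N m(1)) simp_all
qed

section \<open>Derivatives of the operator\<close>

lemma volterra_companion_0: "volterra_companion g f 0 = 0"
  by (simp add: volterra_companion_def)

text \<open>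
  A primitive \<open>G\<close> of the integrand exists on the convex disc, and the integral along the segment is
  its increment.
\<close>

lemma volterra_companion_DERIV:
  assumes f: "f holomorphic_on unit_disc" and g: "g holomorphic_on unit_disc" and z: "z \<in> unit_disc"
  shows "(volterra_companion g f has_field_derivative f z * deriv g z) (at z)"
proof -
  have hol: "(\<lambda>w. f w * deriv g w) holomorphic_on unit_disc"
    by (intro holomorphic_intros f holomorphic_deriv g) auto
  obtain G where G: "\<And>x. x \<in> unit_disc \<Longrightarrow> (G has_field_derivative f x * deriv g x) (at x within unit_disc)"
    using holomorphic_convex_primitive'[OF convex_ball open_ball hol] by blast
  have V: "G x - G 0 = volterra_companion g f x" if x: "x \<in> unit_disc" for x
  proof -
    have "path_image (linepath 0 x) \<subseteq> unit_disc"
      using x by (simp add: closed_segment_subset)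
    then have "((\<lambda>w. f w * deriv g w) has_contour_integral G (pathfinish (linepath 0 x)) - G (pathstart (linepath 0 x))) (linepath 0 x)"
      by (intro contour_integral_primitive[OF G] valid_path_linepath) auto
    then show ?thesis
      unfolding volterra_companion_def by (simp add: contour_integral_unique)
  qed
  have "(G has_field_derivative f z * deriv g z) (at z)"
    using G[OF z] at_within_open[OF z open_ball] by simp
  then have "((\<lambda>x. G x - G 0) has_field_derivative f z * deriv g z) (at z)"
    by (auto intro!: derivative_eq_intros)
  then show ?thesis
    by (rule has_field_derivative_transform_within_open[OF _ open_ball z V])
qed

lemma volterra_companion_linear:
  assumes f: "f holomorphic_on unit_disc" and h: "h holomorphic_on unit_disc"
    and g: "g holomorphic_on unit_disc" and z: "z \<in> unit_disc"
  shows "volterra_companion g (\<lambda>w. a * f w + b * h w) z =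
    a * volterra_companion g f z + b * volterra_companion g h z"
proof -
  have int: "(\<lambda>w. k w * deriv g w) contour_integrable_on linepath 0 z"
    if "k holomorphic_on unit_disc" for k
  proof (rule contour_integrable_continuous_linepath)
    have "closed_segment 0 z \<subseteq> unit_disc" using z by (simp add: closed_segment_subset)
    moreover have "(\<lambda>w. k w * deriv g w) holomorphic_on unit_disc"
      by (intro holomorphic_intros that holomorphic_deriv g) auto
    ultimately show "continuous_on (closed_segment 0 z) (\<lambda>w. k w * deriv g w)"
      using holomorphic_on_imp_continuous_on continuous_on_subset by blast
  qed
  have "(\<lambda>w. (a * f w + b * h w) * deriv g w) =
      (\<lambda>w. a * (f w * deriv g w) + b * (h w * deriv g w))"
    by (simp add: algebra_simps)
  then show ?thesis
    unfolding volterra_companion_def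
    by (simp add: contour_integral_add contour_integral_lmul contour_integrable_lmul int f h)
qed

lemma self_map_in_disc: "analytic_self_map \<phi> \<Longrightarrow> z \<in> unit_disc \<Longrightarrow> \<phi> z \<in> unit_disc"
  unfolding analytic_self_map_def by blast

lemma comp_volterra_DERIV:
  assumes \<phi>: "analytic_self_map \<phi>" and g: "g holomorphic_on unit_disc"
    and f: "f holomorphic_on unit_disc" and z: "z \<in> unit_disc"
  shows "(comp_volterra \<phi> g f has_field_derivative f (\<phi> z) * deriv g (\<phi> z) * deriv \<phi> z) (at z)"
    and "((\<lambda>z. f (\<phi> z) * deriv g (\<phi> z) * deriv \<phi> z) has_field_derivative
           deriv f (\<phi> z) * coeff1 \<phi> g z + f (\<phi> z) * coeff0 \<phi> g z) (at z)"
proof -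
  note \<phi>z = self_map_in_disc[OF \<phi> z]
  have hol: "\<phi> holomorphic_on unit_disc" using \<phi> by (simp add: analytic_self_map_def)
  have d\<phi>: "(\<phi> has_field_derivative deriv \<phi> z) (at z)"
    by (rule holomorphic_disc_DERIV[OF hol z])
  have d\<phi>': "(deriv \<phi> has_field_derivative deriv (deriv \<phi>) z) (at z)"
    by (intro holomorphic_disc_DERIV holomorphic_deriv hol open_ball z)
  have df: "((\<lambda>z. f (\<phi> z)) has_field_derivative deriv f (\<phi> z) * deriv \<phi> z) (at z)"
    by (rule DERIV_chain2[OF holomorphic_disc_DERIV[OF f \<phi>z] d\<phi>])
  have "deriv g holomorphic_on unit_disc" by (intro holomorphic_deriv g open_ball)
  from DERIV_chain2[OF holomorphic_disc_DERIV[OF this \<phi>z] d\<phi>]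
  have dg: "((\<lambda>z. deriv g (\<phi> z)) has_field_derivative deriv (deriv g) (\<phi> z) * deriv \<phi> z) (at z)" .
  show "(comp_volterra \<phi> g f has_field_derivative f (\<phi> z) * deriv g (\<phi> z) * deriv \<phi> z) (at z)"
    unfolding comp_volterra_def by (rule DERIV_chain[OF volterra_companion_DERIV[OF f g \<phi>z] d\<phi>])
  show "((\<lambda>z. f (\<phi> z) * deriv g (\<phi> z) * deriv \<phi> z) has_field_derivative
           deriv f (\<phi> z) * coeff1 \<phi> g z + f (\<phi> z) * coeff0 \<phi> g z) (at z)"
    by (rule DERIV_cong[OF DERIV_mult[OF DERIV_mult[OF df dg] d\<phi>']])
       (simp add: coeff1_def coeff0_def algebra_simps power2_eq_square)
qed

lemma coeff_holomorphic:
  assumes \<phi>: "analytic_self_map \<phi>" and g: "g holomorphic_on unit_disc"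
  shows "coeff0 \<phi> g holomorphic_on unit_disc" "coeff1 \<phi> g holomorphic_on unit_disc"
proof -
  have hol: "\<phi> holomorphic_on unit_disc" and im: "\<phi> ` unit_disc \<subseteq> unit_disc"
    using \<phi> by (auto simp: analytic_self_map_def)
  have c: "(\<lambda>z. h (\<phi> z)) holomorphic_on unit_disc" if "h holomorphic_on unit_disc" for h
    using holomorphic_on_compose_gen[OF hol that im] by (simp add: o_def)
  show "coeff0 \<phi> g holomorphic_on unit_disc" "coeff1 \<phi> g holomorphic_on unit_disc"
    unfolding coeff0_def[abs_def] coeff1_def[abs_def]
    by (intro holomorphic_intros c holomorphic_deriv hol g open_ball)+
qed

section \<open>Boundedness of the operator\<close>

text \<open>
  The right-hand quantities of the theorem. For negative \<open>s\<close> this is the norm of \<open>u\<close> in the weighted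
  space, whatever \<open>\<phi>\<close> is.
\<close>

definition composed_norm :: "real \<Rightarrow> real \<Rightarrow> (complex \<Rightarrow> complex) \<Rightarrow> (complex \<Rightarrow> complex) \<Rightarrow> ennreal" where
  "composed_norm \<beta> s \<phi> u =
     (SUP z\<in>unit_disc. ennreal (std_weight \<beta> z * growth_weight s (cmod (\<phi> z)) * cmod (u z)))"

lemma composed_norm_finite_iff:
  "composed_norm \<beta> s \<phi> u < \<infinity> \<longleftrightarrow>
     (\<exists>M\<ge>0. \<forall>z\<in>unit_disc. std_weight \<beta> z * growth_weight s (cmod (\<phi> z)) * cmod (u z) \<le> M)"
proof
  assume fin: "composed_norm \<beta> s \<phi> u < \<infinity>"
  let ?M = "enn2real (composed_norm \<beta> s \<phi> u)"
  have "std_weight \<beta> z * growth_weight s (cmod (\<phi> z)) * cmod (u z) \<le> ?M" if "z \<in> unit_disc" for z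
  proof -
    have "ennreal (std_weight \<beta> z * growth_weight s (cmod (\<phi> z)) * cmod (u z)) \<le> composed_norm \<beta> s \<phi> u"
      unfolding composed_norm_def using that by (intro SUP_upper)
    also have "\<dots> = ennreal ?M" using fin by simp
    finally show ?thesis by simp
  qed
  then show "\<exists>M\<ge>0. \<forall>z\<in>unit_disc. std_weight \<beta> z * growth_weight s (cmod (\<phi> z)) * cmod (u z) \<le> M"
    using enn2real_nonneg by blast
next
  assume "\<exists>M\<ge>0. \<forall>z\<in>unit_disc. std_weight \<beta> z * growth_weight s (cmod (\<phi> z)) * cmod (u z) \<le> M"
  then obtain M where "\<forall>z\<in>unit_disc. std_weight \<beta> z * growth_weight s (cmod (\<phi> z)) * cmod (u z) \<le> M"
    by blast
  then have "composed_norm \<beta> s \<phi> u \<le> ennreal M"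
    unfolding composed_norm_def by (intro SUP_least ennreal_leI) blast
  then show "composed_norm \<beta> s \<phi> u < \<infinity>"
    using order.strict_trans1 ennreal_less_top infinity_ennreal_def by metis
qed

text \<open>
  The second derivative of the image of \<open>f\<close> is a combination of \<open>f \<circ> \<phi>\<close> and \<open>deriv f \<circ> \<phi>\<close>, to which
  the growth estimates apply. The two terms of the norm at the origin only involve \<open>f\<close> on the closed
  disc of radius \<open>\<bar>\<phi> 0\<bar>\<close>, where everything is bounded.
\<close>

lemma comp_volterra_bounded_sufficient:
  assumes \<alpha>: "0 < \<alpha>" and \<phi>: "analytic_self_map \<phi>" and g: "g holomorphic_on unit_disc"
    and fin1: "composed_norm \<beta> (\<alpha> - 1) \<phi> (coeff1 \<phi> g) < \<infinity>"
    and fin0: "composed_norm \<beta> (\<alpha> - 2) \<phi> (coeff0 \<phi> g) < \<infinity>"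
  shows "bounded_zygmund_operator \<alpha> \<beta> (comp_volterra \<phi> g)"
proof -
  let ?T = "comp_volterra \<phi> g" and ?N = "zygmund_norm \<alpha>"
  let ?W1 = "\<lambda>z. growth_weight (\<alpha> - 1) (cmod (\<phi> z))" and ?W0 = "\<lambda>z. growth_weight (\<alpha> - 2) (cmod (\<phi> z))"
  obtain C where C: "0 \<le> C" and growth: "\<And>f w. f \<in> zygmund_space \<alpha> \<Longrightarrow> w \<in> unit_disc \<Longrightarrow>
     cmod (deriv f w) \<le> C * ?N f * growth_weight (\<alpha> - 1) (cmod w) \<and>
     cmod (f w) \<le> C * ?N f * growth_weight (\<alpha> - 2) (cmod w)"
    using zygmund_growth[OF \<alpha>] by metis
  obtain M1 where M1: "\<And>z. z \<in> unit_disc \<Longrightarrow> std_weight \<beta> z * ?W1 z * cmod (coeff1 \<phi> g z) \<le> M1"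
    using fin1 composed_norm_finite_iff by metis
  obtain M0 where M0: "\<And>z. z \<in> unit_disc \<Longrightarrow> std_weight \<beta> z * ?W0 z * cmod (coeff0 \<phi> g z) \<le> M0"
    using fin0 composed_norm_finite_iff by metis
  have hol: "f holomorphic_on unit_disc" if "f \<in> zygmund_space \<alpha>" for f
    using that by (simp add: zygmund_space_def)
  define b where "b = cmod (\<phi> 0)"
  have b: "0 \<le> b" "b < 1" using self_map_in_disc[OF \<phi>, of 0] by (auto simp: b_def)
  have "continuous_on (cball 0 b) (deriv g)"
  proof -
    have "deriv g holomorphic_on unit_disc" by (intro holomorphic_deriv g open_ball)
    then show ?thesis
      using b by (intro continuous_on_subset[OF holomorphic_on_imp_continuous_on]) auto
  qed
  then have "bounded (deriv g ` cball 0 b)"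
    by (intro compact_imp_bounded compact_continuous_image) auto
  then obtain G where "\<forall>w\<in>cball 0 b. cmod (deriv g w) \<le> G"
    by (auto simp: bounded_iff)
  then have G: "cmod (deriv g w) \<le> G" if "cmod w \<le> b" for w using that by simp
  have G0: "0 \<le> G" using G[of 0] b by (simp add: order_trans[OF norm_ge_zero])
  let ?A = "C * growth_weight (\<alpha> - 2) b * G"
  have A: "cmod (f w * deriv g w) \<le> ?A * ?N f" if f: "f \<in> zygmund_space \<alpha>" and w: "cmod w \<le> b" for f w
  proof -
    have "cmod (f w) \<le> C * ?N f * growth_weight (\<alpha> - 2) (cmod w)"
      using growth[OF f, of w] w b by auto
    also have "\<dots> \<le> C * ?N f * growth_weight (\<alpha> - 2) b"
      using w b C zygmund_norm_at_0(1)[OF f] by (intro mult_left_mono growth_weight_mono) auto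
    finally have "cmod (f w) * cmod (deriv g w) \<le> (C * ?N f * growth_weight (\<alpha> - 2) b) * G"
      using G[OF w] by (intro mult_mono') auto
    then show ?thesis by (simp add: norm_mult mult_ac)
  qed
  have main: "?T f \<in> zygmund_space \<beta> \<and>
      zygmund_norm \<beta> (?T f) \<le> (?A + ?A * cmod (deriv \<phi> 0) + C * (M1 + M0)) * ?N f"
    if f: "f \<in> zygmund_space \<alpha>" for f
  proof -
    let ?n = "?N f"
    have n: "0 \<le> ?n" by (rule zygmund_norm_at_0(1)[OF f])
    note d = comp_volterra_DERIV[OF \<phi> g hol[OF f]]
    have "std_weight \<beta> z * cmod (deriv f (\<phi> z) * coeff1 \<phi> g z + f (\<phi> z) * coeff0 \<phi> g z)
        \<le> C * (M1 + M0) * ?n" if z: "z \<in> unit_disc" for z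
    proof -
      have v: "0 \<le> std_weight \<beta> z" by (simp add: std_weight_def)
      note gr = growth[OF f self_map_in_disc[OF \<phi> z]]
      have "std_weight \<beta> z * cmod (deriv f (\<phi> z) * coeff1 \<phi> g z + f (\<phi> z) * coeff0 \<phi> g z)
          \<le> std_weight \<beta> z * (cmod (deriv f (\<phi> z)) * cmod (coeff1 \<phi> g z) + cmod (f (\<phi> z)) * cmod (coeff0 \<phi> g z))"
        using v by (intro mult_left_mono) (metis norm_mult norm_triangle_ineq)
      also have "\<dots> \<le> std_weight \<beta> z * ((C * ?n * ?W1 z) * cmod (coeff1 \<phi> g z) + (C * ?n * ?W0 z) * cmod (coeff0 \<phi> g z))"
        using v gr by (intro mult_left_mono add_mono mult_right_mono) auto
      also have "\<dots> = C * ?n * (std_weight \<beta> z * ?W1 z * cmod (coeff1 \<phi> g z) + std_weight \<beta> z * ?W0 z * cmod (coeff0 \<phi> g z))"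
        by (simp add: algebra_simps)
      also have "\<dots> \<le> C * ?n * (M1 + M0)"
        using C n M1[OF z] M0[OF z] by (intro mult_left_mono add_mono mult_nonneg_nonneg) auto
      finally show ?thesis by (simp add: mult_ac)
    qed
    note m = zygmund_memI[OF d this]
    have "cmod (?T f 0) \<le> ?A * ?n * 1"
    proof -
      have seg: "closed_segment 0 (\<phi> 0) \<subseteq> cball 0 b"
        by (intro closed_segment_subset) (auto simp: b_def)
      have "cmod (volterra_companion g f (\<phi> 0) - volterra_companion g f 0) \<le> ?A * ?n * cmod (\<phi> 0 - 0)"
      proof (rule field_differentiable_bound[where S = "cball 0 b" and f' = "\<lambda>w. f w * deriv g w"])
        fix w :: complex assume w: "w \<in> cball 0 b"
        then have "w \<in> unit_disc" using b by auto
        then show "(volterra_companion g f has_field_derivative f w * deriv g w) (at w within cball 0 b)"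
          using volterra_companion_DERIV[OF hol[OF f] g] has_field_derivative_at_within by blast
        show "cmod (f w * deriv g w) \<le> ?A * ?n" using A[OF f, of w] w by simp
      qed (auto simp: b_def)
      also have "\<dots> \<le> ?A * ?n * 1"
        using b C G0 n growth_weight_pos[OF b, of "\<alpha> - 2"]
        by (intro mult_left_mono mult_nonneg_nonneg) (auto simp: b_def)
      finally show ?thesis by (simp add: comp_volterra_def volterra_companion_0)
    qed
    moreover have "cmod (f (\<phi> 0) * deriv g (\<phi> 0) * deriv \<phi> 0) \<le> ?A * ?n * cmod (deriv \<phi> 0)"
      using mult_right_mono[OF A[OF f, of "\<phi> 0"], of "cmod (deriv \<phi> 0)"]
      by (simp add: b_def norm_mult)
    ultimately have "zygmund_norm \<beta> (?T f) \<le> ?A * ?n * 1 + ?A * ?n * cmod (deriv \<phi> 0) + C * (M1 + M0) * ?n"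
      using m(2) by linarith
    then show ?thesis using m(1) by (simp add: algebra_simps)
  qed
  moreover have "?T (\<lambda>w. a * f w + c * h w) z = a * ?T f z + c * ?T h z"
    if "f \<in> zygmund_space \<alpha>" "h \<in> zygmund_space \<alpha>" "z \<in> unit_disc" for f h a c z
    unfolding comp_volterra_def o_def
    by (intro volterra_companion_linear hol that g self_map_in_disc[OF \<phi>])
  ultimately show ?thesis
    unfolding bounded_zygmund_operator_def by blast
qed

text \<open>
  The test functions at \<open>a = \<phi> z\<close> give the two conditions in turn. The one vanishing at \<open>a\<close> isolates
  \<open>coeff1\<close>. For the other one, the term with \<open>coeff1\<close> is already under control by the first
  condition together with the growth estimate for \<open>deriv f\<close>, which leaves \<open>coeff0\<close>.
\<close>

lemma comp_volterra_bounded_necessary: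
  assumes \<alpha>: "0 < \<alpha>" and \<phi>: "analytic_self_map \<phi>" and g: "g holomorphic_on unit_disc"
    and bdd: "bounded_zygmund_operator \<alpha> \<beta> (comp_volterra \<phi> g)"
  shows "composed_norm \<beta> (\<alpha> - 1) \<phi> (coeff1 \<phi> g) < \<infinity>"
    and "composed_norm \<beta> (\<alpha> - 2) \<phi> (coeff0 \<phi> g) < \<infinity>"
proof -
  let ?T = "comp_volterra \<phi> g"
  let ?W1 = "\<lambda>z. growth_weight (\<alpha> - 1) (cmod (\<phi> z))" and ?W0 = "\<lambda>z. growth_weight (\<alpha> - 2) (cmod (\<phi> z))"
  from bdd obtain K where mem: "\<And>f. f \<in> zygmund_space \<alpha> \<Longrightarrow> ?T f \<in> zygmund_space \<beta>"
    and K: "\<And>f. f \<in> zygmund_space \<alpha> \<Longrightarrow> zygmund_norm \<beta> (?T f) \<le> K * zygmund_norm \<alpha> f"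
    unfolding bounded_zygmund_operator_def by blast
  have test: "std_weight \<beta> z * cmod (deriv f (\<phi> z) * coeff1 \<phi> g z + f (\<phi> z) * coeff0 \<phi> g z) \<le> \<bar>K\<bar> * N"
    if f: "f \<in> zygmund_space \<alpha>" and N: "zygmund_norm \<alpha> f \<le> N" and z: "z \<in> unit_disc" for f N z
  proof -
    have hol: "f holomorphic_on unit_disc" using f by (simp add: zygmund_space_def)
    have "std_weight \<beta> z * cmod (deriv f (\<phi> z) * coeff1 \<phi> g z + f (\<phi> z) * coeff0 \<phi> g z)
        = std_weight \<beta> z * cmod (deriv (deriv (?T f)) z)"
      using disc_second_deriv(2)[OF comp_volterra_DERIV[OF \<phi> g hol] z] by simp
    also have "\<dots> \<le> zygmund_norm \<beta> (?T f)" by (rule zygmund_bound[OF mem[OF f] z])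
    also have "\<dots> \<le> K * zygmund_norm \<alpha> f" by (rule K[OF f])
    also have "\<dots> \<le> \<bar>K\<bar> * N"
      using zygmund_norm_at_0(1)[OF f] N by (intro mult_mono) auto
    finally show ?thesis .
  qed
  have v: "0 \<le> std_weight \<beta> z" for z by (simp add: std_weight_def)
  have W: "0 \<le> growth_weight s (cmod (\<phi> z))" if "z \<in> unit_disc" for s z
    using growth_weight_pos[of "cmod (\<phi> z)" s] self_map_in_disc[OF \<phi> that] by simp
  obtain N1 where N1: "\<forall>a\<in>unit_disc. \<exists>f\<in>zygmund_space \<alpha>. zygmund_norm \<alpha> f \<le> N1 \<and>
     f a = 0 \<and> deriv f a = of_real (growth_weight (\<alpha> - 1) (cmod a))"
    using zygmund_derivative_test[OF \<alpha>] by blast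
  have M1: "std_weight \<beta> z * ?W1 z * cmod (coeff1 \<phi> g z) \<le> \<bar>K\<bar> * N1" if z: "z \<in> unit_disc" for z
  proof -
    obtain f where f: "f \<in> zygmund_space \<alpha>" "zygmund_norm \<alpha> f \<le> N1"
      "f (\<phi> z) = 0" "deriv f (\<phi> z) = of_real (?W1 z)"
      using bspec[OF N1 self_map_in_disc[OF \<phi> z]] by blast
    show ?thesis using test[OF f(1,2) z] f(3,4) W[OF z] by (simp add: norm_mult mult_ac)
  qed
  have "\<bar>K\<bar> * N1 \<ge> 0"
    using M1[of 0] v W[of 0] by (auto intro: order_trans[rotated] mult_nonneg_nonneg)
  then show "composed_norm \<beta> (\<alpha> - 1) \<phi> (coeff1 \<phi> g) < \<infinity>"
    using M1 composed_norm_finite_iff by blast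
  obtain C where C: "0 \<le> C" and growth: "\<And>f w. f \<in> zygmund_space \<alpha> \<Longrightarrow> w \<in> unit_disc \<Longrightarrow>
     cmod (deriv f w) \<le> C * zygmund_norm \<alpha> f * growth_weight (\<alpha> - 1) (cmod w)"
    using zygmund_growth[OF \<alpha>] by metis
  obtain N0 where N0: "\<forall>a\<in>unit_disc. \<exists>f\<in>zygmund_space \<alpha>. zygmund_norm \<alpha> f \<le> N0 \<and>
     f a = of_real (growth_weight (\<alpha> - 2) (cmod a))"
    using zygmund_value_test[OF \<alpha>] by blast
  let ?B = "\<bar>K\<bar> * N0 + C * N0 * (\<bar>K\<bar> * N1)"
  have M0: "std_weight \<beta> z * ?W0 z * cmod (coeff0 \<phi> g z) \<le> ?B" if z: "z \<in> unit_disc" for z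
  proof -
    obtain f where f: "f \<in> zygmund_space \<alpha>" "zygmund_norm \<alpha> f \<le> N0" "f (\<phi> z) = of_real (?W0 z)"
      using bspec[OF N0 self_map_in_disc[OF \<phi> z]] by blast
    let ?x = "deriv f (\<phi> z) * coeff1 \<phi> g z" and ?y = "f (\<phi> z) * coeff0 \<phi> g z"
    have N0': "0 \<le> N0" using zygmund_norm_at_0(1)[OF f(1)] f(2) by linarith
    have "cmod (deriv f (\<phi> z)) \<le> C * zygmund_norm \<alpha> f * ?W1 z"
      by (rule growth[OF f(1) self_map_in_disc[OF \<phi> z]])
    also have "\<dots> \<le> C * N0 * ?W1 z"
      using f(2) C W[OF z] by (intro mult_right_mono mult_left_mono) auto
    finally have "std_weight \<beta> z * cmod ?x \<le> std_weight \<beta> z * (C * N0 * ?W1 z * cmod (coeff1 \<phi> g z))"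
      unfolding norm_mult by (intro mult_left_mono mult_right_mono v) auto
    also have "\<dots> = C * N0 * (std_weight \<beta> z * ?W1 z * cmod (coeff1 \<phi> g z))" by (simp add: mult_ac)
    also have "\<dots> \<le> C * N0 * (\<bar>K\<bar> * N1)"
      using M1[OF z] C N0' by (intro mult_left_mono mult_nonneg_nonneg) auto
    finally have x: "std_weight \<beta> z * cmod ?x \<le> C * N0 * (\<bar>K\<bar> * N1)" .
    have "cmod ?y \<le> cmod (?x + ?y) + cmod ?x"
      using norm_triangle_ineq4[of "?x + ?y" ?x] by simp
    then have "std_weight \<beta> z * cmod ?y \<le> std_weight \<beta> z * cmod (?x + ?y) + std_weight \<beta> z * cmod ?x"
      unfolding distrib_left[symmetric] by (rule mult_left_mono[OF _ v])
    also have "\<dots> \<le> ?B" by (intro add_mono x test[OF f(1,2) z])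
    finally show ?thesis using f(3) W[OF z] by (simp add: norm_mult mult_ac)
  qed
  have "?B \<ge> 0"
    using M0[of 0] v W[of 0] by (auto intro: order_trans[rotated] mult_nonneg_nonneg)
  then show "composed_norm \<beta> (\<alpha> - 2) \<phi> (coeff0 \<phi> g) < \<infinity>"
    using M0 composed_norm_finite_iff by blast
qed

lemma comp_volterra_bounded_iff:
  assumes "0 < \<alpha>" "analytic_self_map \<phi>" "g holomorphic_on unit_disc"
  shows "bounded_zygmund_operator \<alpha> \<beta> (comp_volterra \<phi> g) \<longleftrightarrow>
    composed_norm \<beta> (\<alpha> - 1) \<phi> (coeff1 \<phi> g) < \<infinity> \<and> composed_norm \<beta> (\<alpha> - 2) \<phi> (coeff0 \<phi> g) < \<infinity>"
  using comp_volterra_bounded_sufficient[OF assms] comp_volterra_bounded_necessary[OF assms] by blast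

section \<open>Powers of the symbol and the five cases\<close>

text \<open>
  The left-hand quantities of the theorem, in terms of the powers of \<open>\<phi>\<close>.
\<close>

definition moment_norm :: "real \<Rightarrow> real \<Rightarrow> (complex \<Rightarrow> complex) \<Rightarrow> (complex \<Rightarrow> complex) \<Rightarrow> ennreal" where
  "moment_norm \<beta> s \<phi> u =
     (SUP n. ennreal (moment_weight s n) * weighted_norm \<beta> (\<lambda>z. u z * \<phi> z ^ n))"

text \<open>
  The two suprema, over \<open>n\<close> and over \<open>z\<close>, can be exchanged, so the comparison is the pointwise
  one between \<open>moment_weight s n * r ^ n\<close> and \<open>growth_weight s r\<close> at \<open>r = \<bar>\<phi> z\<bar>\<close>. It holds for all
  \<open>u\<close> and \<open>\<phi>\<close> with constants depending only on \<open>s\<close>; hence a condition that the two quantities are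
  comparable and finite reduces to finiteness of the second.
\<close>

lemma moment_norm_comparable:
  assumes "0 \<le> s"
  shows "\<exists>C1>0. \<exists>C2>0. \<forall>\<beta> \<phi> u. analytic_self_map \<phi> \<longrightarrow>
    (comparable_finite C1 C2 (moment_norm \<beta> s \<phi> u) (composed_norm \<beta> s \<phi> u) \<longleftrightarrow>
       composed_norm \<beta> s \<phi> u < \<infinity>)"
proof -
  obtain c1 where c1: "c1 > 0" and le1: "\<And>r n. 0 \<le> r \<Longrightarrow> r < 1 \<Longrightarrow> c1 * (moment_weight s n * r ^ n) \<le> growth_weight s r"
    using moment_le_growth_weight[OF assms] by blast
  obtain c2 where c2: "c2 > 0" and le2: "\<And>r. 0 \<le> r \<Longrightarrow> r < 1 \<Longrightarrow> \<exists>n. growth_weight s r \<le> c2 * (moment_weight s n * r ^ n)"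
    using growth_weight_le_moment[OF assms] by blast
  have "comparable_finite c1 c2 (moment_norm \<beta> s \<phi> u) (composed_norm \<beta> s \<phi> u) \<longleftrightarrow>
       composed_norm \<beta> s \<phi> u < \<infinity>" if \<phi>: "analytic_self_map \<phi>" for \<beta> \<phi> u
  proof -
    let ?A = "moment_norm \<beta> s \<phi> u" and ?B = "composed_norm \<beta> s \<phi> u"
    let ?a = "\<lambda>n z. moment_weight s n * (std_weight \<beta> z * cmod (u z * \<phi> z ^ n))"
    have v: "0 \<le> std_weight \<beta> z" for z by (simp add: std_weight_def)
    have r: "cmod (\<phi> z) < 1" if "z \<in> unit_disc" for z
      using self_map_in_disc[OF \<phi> that] by simp
    have A: "?A = (SUP n. SUP z\<in>unit_disc. ennreal (?a n z))"
      unfolding moment_norm_def weighted_norm_def SUP_mult_left_ennreal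
      by (simp add: ennreal_mult' moment_weight_nonneg)
    have lower: "ennreal c1 * ?A \<le> ?B"
      unfolding A SUP_mult_left_ennreal
    proof (intro SUP_least)
      fix n z assume z: "z \<in> unit_disc"
      have "ennreal c1 * ennreal (?a n z) = ennreal (c1 * ?a n z)"
        using c1 by (simp add: ennreal_mult')
      also have "\<dots> \<le> ennreal (std_weight \<beta> z * growth_weight s (cmod (\<phi> z)) * cmod (u z))"
      proof (rule ennreal_leI)
        have "std_weight \<beta> z * (c1 * (moment_weight s n * cmod (\<phi> z) ^ n)) * cmod (u z)
            \<le> std_weight \<beta> z * growth_weight s (cmod (\<phi> z)) * cmod (u z)"
          using le1[OF norm_ge_zero r[OF z]] v by (intro mult_right_mono mult_left_mono) auto
        then show "c1 * ?a n z \<le> std_weight \<beta> z * growth_weight s (cmod (\<phi> z)) * cmod (u z)"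
          by (simp add: norm_mult norm_power mult_ac)
      qed
      also have "\<dots> \<le> ?B" unfolding composed_norm_def using z by (intro SUP_upper)
      finally show "ennreal c1 * ennreal (?a n z) \<le> ?B" .
    qed
    have upper: "?B \<le> ennreal c2 * ?A"
      unfolding composed_norm_def
    proof (intro SUP_least)
      fix z assume z: "z \<in> unit_disc"
      obtain n where n: "growth_weight s (cmod (\<phi> z)) \<le> c2 * (moment_weight s n * cmod (\<phi> z) ^ n)"
        using le2[OF norm_ge_zero r[OF z]] by blast
      have "std_weight \<beta> z * growth_weight s (cmod (\<phi> z)) * cmod (u z)
          \<le> std_weight \<beta> z * (c2 * (moment_weight s n * cmod (\<phi> z) ^ n)) * cmod (u z)"
        using n v by (intro mult_right_mono mult_left_mono) auto
      also have "\<dots> = c2 * ?a n z" by (simp add: norm_mult norm_power mult_ac)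
      finally have "ennreal (std_weight \<beta> z * growth_weight s (cmod (\<phi> z)) * cmod (u z)) \<le> ennreal c2 * ennreal (?a n z)"
        using c2 by (simp add: ennreal_leI flip: ennreal_mult')
      also have "\<dots> \<le> ennreal c2 * ?A"
        unfolding A using z by (intro mult_left_mono SUP_upper2[of n] SUP_upper) auto
      finally show "ennreal (std_weight \<beta> z * growth_weight s (cmod (\<phi> z)) * cmod (u z)) \<le> ennreal c2 * ?A" .
    qed
    have "?A < \<infinity>" if "?B < \<infinity>"
    proof (rule ccontr)
      assume "\<not> ?A < \<infinity>"
      then have "?A = \<infinity>" by (simp add: less_top[symmetric])
      then show False using lower that c1 by (simp add: ennreal_mult_top top_unique)
    qed
    then show ?thesis using lower upper unfolding comparable_finite_def by blast
  qed
  then show ?thesis using c1 c2 by blast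
qed

lemma composed_norm_neg:
  assumes "s < 0" "u holomorphic_on unit_disc"
  shows "composed_norm \<beta> s \<phi> u < \<infinity> \<longleftrightarrow> u \<in> weighted_Hinf \<beta>"
  using assms by (simp add: composed_norm_def weighted_norm_def weighted_Hinf_def growth_weight_def)

lemma composed_norm_0:
  "composed_norm \<beta> 0 \<phi> u = (SUP z\<in>unit_disc. ennreal ((1 - (cmod z)\<^sup>2) powr \<beta> *
     ln (2 / (1 - (cmod (\<phi> z))\<^sup>2)) * cmod (u z)))"
  by (simp add: composed_norm_def growth_weight_def std_weight_def)

lemma composed_norm_pos:
  assumes "0 < s"
  shows "composed_norm \<beta> s \<phi> u = (SUP z\<in>unit_disc. ennreal ((1 - (cmod z)\<^sup>2) powr \<beta> /
     (1 - (cmod (\<phi> z))\<^sup>2) powr s * cmod (u z)))"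
  using assms by (simp add: composed_norm_def growth_weight_def std_weight_def powr_minus divide_inverse)

lemma composed_norm_1:
  assumes "analytic_self_map \<phi>"
  shows "composed_norm \<beta> 1 \<phi> u = (SUP z\<in>unit_disc. ennreal ((1 - (cmod z)\<^sup>2) powr \<beta> /
     (1 - (cmod (\<phi> z))\<^sup>2) * cmod (u z)))"
proof -
  have "(1 - (cmod (\<phi> z))\<^sup>2) powr 1 = 1 - (cmod (\<phi> z))\<^sup>2" if "z \<in> unit_disc" for z
    using self_map_in_disc[OF assms that] one_minus_square_bounds(1)[of "cmod (\<phi> z)"]
    by (intro powr_one) simp
  then show ?thesis
    unfolding composed_norm_pos[OF zero_less_one] by (intro SUP_cong) simp_all
qed

lemma moment_norm_0:
  "moment_norm \<beta> 0 \<phi> u = (SUP n::nat. ennreal (ln (real n + 2)) * weighted_norm \<beta> (\<lambda>z. u z * \<phi> z ^ n))"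
  by (simp add: moment_norm_def moment_weight_def)

lemma moment_norm_pos:
  assumes "0 < s"
  shows "moment_norm \<beta> s \<phi> u =
    (SUP n::nat. ennreal ((real n + 1) powr s) * weighted_norm \<beta> (\<lambda>z. u z * \<phi> z ^ n))"
  using assms by (simp add: moment_norm_def moment_weight_def)

lemma moment_norm_1:
  "moment_norm \<beta> 1 \<phi> u = (SUP n::nat. ennreal (real n + 1) * weighted_norm \<beta> (\<lambda>z. u z * \<phi> z ^ n))"
  by (simp add: moment_norm_pos)

theorem theorem2p3:
  fixes \<alpha> \<beta> :: real
  assumes "0 < \<beta>"
  shows "(0 < \<alpha> \<and> \<alpha> < 1 \<longrightarrow>
      (\<forall>\<phi> g. analytic_self_map \<phi> \<longrightarrow> g holomorphic_on unit_disc \<longrightarrow>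
        (bounded_zygmund_operator \<alpha> \<beta> (comp_volterra \<phi> g) \<longleftrightarrow>
          coeff0 \<phi> g \<in> weighted_Hinf \<beta> \<and> coeff1 \<phi> g \<in> weighted_Hinf \<beta>)))
  \<and> (\<alpha> = 1 \<longrightarrow>
      (\<exists>C1>0. \<exists>C2>0. \<forall>\<phi> g. analytic_self_map \<phi> \<longrightarrow> g holomorphic_on unit_disc \<longrightarrow>
        (bounded_zygmund_operator \<alpha> \<beta> (comp_volterra \<phi> g) \<longleftrightarrow>
          coeff0 \<phi> g \<in> weighted_Hinf \<beta> \<and>
          comparable_finite C1 C2
            (SUP n::nat. ennreal (ln (real n + 2)) *
               weighted_norm \<beta> (\<lambda>z. coeff1 \<phi> g z * \<phi> z ^ n))
            (SUP z\<in>unit_disc. ennreal ((1 - (cmod z)\<^sup>2) powr \<beta> *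
               ln (2 / (1 - (cmod (\<phi> z))\<^sup>2)) * cmod (coeff1 \<phi> g z))))))
  \<and> (1 < \<alpha> \<and> \<alpha> < 2 \<longrightarrow>
      (\<exists>C1>0. \<exists>C2>0. \<forall>\<phi> g. analytic_self_map \<phi> \<longrightarrow> g holomorphic_on unit_disc \<longrightarrow>
        (bounded_zygmund_operator \<alpha> \<beta> (comp_volterra \<phi> g) \<longleftrightarrow>
          coeff0 \<phi> g \<in> weighted_Hinf \<beta> \<and>
          comparable_finite C1 C2
            (SUP n::nat. ennreal ((real n + 1) powr (\<alpha> - 1)) *
               weighted_norm \<beta> (\<lambda>z. coeff1 \<phi> g z * \<phi> z ^ n))
            (SUP z\<in>unit_disc. ennreal ((1 - (cmod z)\<^sup>2) powr \<beta> /
               (1 - (cmod (\<phi> z))\<^sup>2) powr (\<alpha> - 1) * cmod (coeff1 \<phi> g z))))))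
  \<and> (\<alpha> = 2 \<longrightarrow>
      (\<exists>C1>0. \<exists>C2>0. \<exists>C3>0. \<exists>C4>0.
       \<forall>\<phi> g. analytic_self_map \<phi> \<longrightarrow> g holomorphic_on unit_disc \<longrightarrow>
        (bounded_zygmund_operator \<alpha> \<beta> (comp_volterra \<phi> g) \<longleftrightarrow>
          comparable_finite C1 C2
            (SUP n::nat. ennreal (real n + 1) *
               weighted_norm \<beta> (\<lambda>z. coeff1 \<phi> g z * \<phi> z ^ n))
            (SUP z\<in>unit_disc. ennreal ((1 - (cmod z)\<^sup>2) powr \<beta> /
               (1 - (cmod (\<phi> z))\<^sup>2) * cmod (coeff1 \<phi> g z))) \<and>
          comparable_finite C3 C4
            (SUP n::nat. ennreal (ln (real n + 2)) *
               weighted_norm \<beta> (\<lambda>z. coeff0 \<phi> g z * \<phi> z ^ n))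
            (SUP z\<in>unit_disc. ennreal ((1 - (cmod z)\<^sup>2) powr \<beta> *
               ln (2 / (1 - (cmod (\<phi> z))\<^sup>2)) * cmod (coeff0 \<phi> g z))))))
  \<and> (2 < \<alpha> \<longrightarrow>
      (\<exists>C1>0. \<exists>C2>0. \<exists>C3>0. \<exists>C4>0.
       \<forall>\<phi> g. analytic_self_map \<phi> \<longrightarrow> g holomorphic_on unit_disc \<longrightarrow>
        (bounded_zygmund_operator \<alpha> \<beta> (comp_volterra \<phi> g) \<longleftrightarrow>
          comparable_finite C1 C2
            (SUP n::nat. ennreal ((real n + 1) powr (\<alpha> - 1)) *
               weighted_norm \<beta> (\<lambda>z. coeff1 \<phi> g z * \<phi> z ^ n))
            (SUP z\<in>unit_disc. ennreal ((1 - (cmod z)\<^sup>2) powr \<beta> /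
               (1 - (cmod (\<phi> z))\<^sup>2) powr (\<alpha> - 1) * cmod (coeff1 \<phi> g z))) \<and>
          comparable_finite C3 C4
            (SUP n::nat. ennreal ((real n + 1) powr (\<alpha> - 2)) *
               weighted_norm \<beta> (\<lambda>z. coeff0 \<phi> g z * \<phi> z ^ n))
            (SUP z\<in>unit_disc. ennreal ((1 - (cmod z)\<^sup>2) powr \<beta> /
               (1 - (cmod (\<phi> z))\<^sup>2) powr (\<alpha> - 2) * cmod (coeff0 \<phi> g z))))))"
proof (intro conjI impI)
  assume \<alpha>: "0 < \<alpha> \<and> \<alpha> < 1"
  then show "\<forall>\<phi> g. analytic_self_map \<phi> \<longrightarrow> g holomorphic_on unit_disc \<longrightarrow>
        (bounded_zygmund_operator \<alpha> \<beta> (comp_volterra \<phi> g) \<longleftrightarrow>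
          coeff0 \<phi> g \<in> weighted_Hinf \<beta> \<and> coeff1 \<phi> g \<in> weighted_Hinf \<beta>)"
    using comp_volterra_bounded_iff[of \<alpha>] composed_norm_neg coeff_holomorphic by auto
next
  \<comment> \<open>Here \<open>\<alpha> - 1 = 0\<close> is the logarithmic order and \<open>\<alpha> - 2 = - 1\<close> a bounded one.\<close>
  assume \<alpha>: "\<alpha> = 1"
  obtain C1 C2 where C: "C1 > 0" "C2 > 0" and cmp: "\<And>\<beta> \<phi> u. analytic_self_map \<phi> \<Longrightarrow>
    comparable_finite C1 C2 (moment_norm \<beta> 0 \<phi> u) (composed_norm \<beta> 0 \<phi> u) \<longleftrightarrow>
       composed_norm \<beta> 0 \<phi> u < \<infinity>"
    using moment_norm_comparable[of 0] by auto
  show "\<exists>C1>0. \<exists>C2>0. \<forall>\<phi> g. analytic_self_map \<phi> \<longrightarrow> g holomorphic_on unit_disc \<longrightarrow>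
        (bounded_zygmund_operator \<alpha> \<beta> (comp_volterra \<phi> g) \<longleftrightarrow>
          coeff0 \<phi> g \<in> weighted_Hinf \<beta> \<and>
          comparable_finite C1 C2
            (SUP n::nat. ennreal (ln (real n + 2)) *
               weighted_norm \<beta> (\<lambda>z. coeff1 \<phi> g z * \<phi> z ^ n))
            (SUP z\<in>unit_disc. ennreal ((1 - (cmod z)\<^sup>2) powr \<beta> *
               ln (2 / (1 - (cmod (\<phi> z))\<^sup>2)) * cmod (coeff1 \<phi> g z))))"
    unfolding moment_norm_0[symmetric] composed_norm_0[symmetric]
  proof (rule exI[of _ C1], intro conjI C exI[of _ C2] allI impI)
    fix \<phi> g assume *: "analytic_self_map \<phi>" "g holomorphic_on unit_disc"
    show "bounded_zygmund_operator \<alpha> \<beta> (comp_volterra \<phi> g) \<longleftrightarrow>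
          coeff0 \<phi> g \<in> weighted_Hinf \<beta> \<and>
          comparable_finite C1 C2 (moment_norm \<beta> 0 \<phi> (coeff1 \<phi> g)) (composed_norm \<beta> 0 \<phi> (coeff1 \<phi> g))"
      using comp_volterra_bounded_iff[OF _ *, of \<alpha> \<beta>] \<alpha> cmp[OF *(1)]
        composed_norm_neg[of "-1" "coeff0 \<phi> g" \<beta> \<phi>] coeff_holomorphic(1)[OF *] by auto
  qed
next
  assume \<alpha>: "1 < \<alpha> \<and> \<alpha> < 2"
  then have s: "0 < \<alpha> - 1" by simp
  obtain C1 C2 where C: "C1 > 0" "C2 > 0" and cmp: "\<And>\<beta> \<phi> u. analytic_self_map \<phi> \<Longrightarrow>
    comparable_finite C1 C2 (moment_norm \<beta> (\<alpha> - 1) \<phi> u) (composed_norm \<beta> (\<alpha> - 1) \<phi> u) \<longleftrightarrow>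
       composed_norm \<beta> (\<alpha> - 1) \<phi> u < \<infinity>"
    using moment_norm_comparable[of "\<alpha> - 1"] s by auto
  show "\<exists>C1>0. \<exists>C2>0. \<forall>\<phi> g. analytic_self_map \<phi> \<longrightarrow> g holomorphic_on unit_disc \<longrightarrow>
        (bounded_zygmund_operator \<alpha> \<beta> (comp_volterra \<phi> g) \<longleftrightarrow>
          coeff0 \<phi> g \<in> weighted_Hinf \<beta> \<and>
          comparable_finite C1 C2
            (SUP n::nat. ennreal ((real n + 1) powr (\<alpha> - 1)) *
               weighted_norm \<beta> (\<lambda>z. coeff1 \<phi> g z * \<phi> z ^ n))
            (SUP z\<in>unit_disc. ennreal ((1 - (cmod z)\<^sup>2) powr \<beta> /
               (1 - (cmod (\<phi> z))\<^sup>2) powr (\<alpha> - 1) * cmod (coeff1 \<phi> g z))))"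
    unfolding moment_norm_pos[OF s, symmetric] composed_norm_pos[OF s, symmetric]
  proof (rule exI[of _ C1], intro conjI C exI[of _ C2] allI impI)
    fix \<phi> g assume *: "analytic_self_map \<phi>" "g holomorphic_on unit_disc"
    show "bounded_zygmund_operator \<alpha> \<beta> (comp_volterra \<phi> g) \<longleftrightarrow>
          coeff0 \<phi> g \<in> weighted_Hinf \<beta> \<and>
          comparable_finite C1 C2 (moment_norm \<beta> (\<alpha> - 1) \<phi> (coeff1 \<phi> g))
            (composed_norm \<beta> (\<alpha> - 1) \<phi> (coeff1 \<phi> g))"
      using comp_volterra_bounded_iff[OF _ *, of \<alpha> \<beta>] \<alpha> cmp[OF *(1)]
        composed_norm_neg[of "\<alpha> - 2" "coeff0 \<phi> g" \<beta> \<phi>] coeff_holomorphic(1)[OF *] by auto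
  qed
next
  \<comment> \<open>Here \<open>\<alpha> - 2 = 0\<close> is the logarithmic order, and \<open>\<alpha> - 1 = 1\<close> gives the first power without \<open>powr\<close>.\<close>
  assume \<alpha>: "\<alpha> = 2"
  obtain C1 C2 where C: "C1 > 0" "C2 > 0" and cmp1: "\<And>\<beta> \<phi> u. analytic_self_map \<phi> \<Longrightarrow>
    comparable_finite C1 C2 (moment_norm \<beta> 1 \<phi> u) (composed_norm \<beta> 1 \<phi> u) \<longleftrightarrow>
       composed_norm \<beta> 1 \<phi> u < \<infinity>"
    using moment_norm_comparable[of 1] by auto
  obtain C3 C4 where C': "C3 > 0" "C4 > 0" and cmp0: "\<And>\<beta> \<phi> u. analytic_self_map \<phi> \<Longrightarrow>
    comparable_finite C3 C4 (moment_norm \<beta> 0 \<phi> u) (composed_norm \<beta> 0 \<phi> u) \<longleftrightarrow>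
       composed_norm \<beta> 0 \<phi> u < \<infinity>"
    using moment_norm_comparable[of 0] by auto
  have "bounded_zygmund_operator \<alpha> \<beta> (comp_volterra \<phi> g) \<longleftrightarrow>
          comparable_finite C1 C2
            (SUP n::nat. ennreal (real n + 1) *
               weighted_norm \<beta> (\<lambda>z. coeff1 \<phi> g z * \<phi> z ^ n))
            (SUP z\<in>unit_disc. ennreal ((1 - (cmod z)\<^sup>2) powr \<beta> /
               (1 - (cmod (\<phi> z))\<^sup>2) * cmod (coeff1 \<phi> g z))) \<and>
          comparable_finite C3 C4
            (SUP n::nat. ennreal (ln (real n + 2)) *
               weighted_norm \<beta> (\<lambda>z. coeff0 \<phi> g z * \<phi> z ^ n))
            (SUP z\<in>unit_disc. ennreal ((1 - (cmod z)\<^sup>2) powr \<beta> *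
               ln (2 / (1 - (cmod (\<phi> z))\<^sup>2)) * cmod (coeff0 \<phi> g z)))"
    if *: "analytic_self_map \<phi>" "g holomorphic_on unit_disc" for \<phi> g
    unfolding moment_norm_0[symmetric] composed_norm_0[symmetric]
      moment_norm_1[symmetric] composed_norm_1[OF *(1), symmetric]
    using comp_volterra_bounded_iff[OF _ *, of \<alpha> \<beta>] \<alpha> cmp1[OF *(1)] cmp0[OF *(1)] by simp
  then show "\<exists>C1>0. \<exists>C2>0. \<exists>C3>0. \<exists>C4>0.
       \<forall>\<phi> g. analytic_self_map \<phi> \<longrightarrow> g holomorphic_on unit_disc \<longrightarrow>
        (bounded_zygmund_operator \<alpha> \<beta> (comp_volterra \<phi> g) \<longleftrightarrow>
          comparable_finite C1 C2
            (SUP n::nat. ennreal (real n + 1) *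
               weighted_norm \<beta> (\<lambda>z. coeff1 \<phi> g z * \<phi> z ^ n))
            (SUP z\<in>unit_disc. ennreal ((1 - (cmod z)\<^sup>2) powr \<beta> /
               (1 - (cmod (\<phi> z))\<^sup>2) * cmod (coeff1 \<phi> g z))) \<and>
          comparable_finite C3 C4
            (SUP n::nat. ennreal (ln (real n + 2)) *
               weighted_norm \<beta> (\<lambda>z. coeff0 \<phi> g z * \<phi> z ^ n))
            (SUP z\<in>unit_disc. ennreal ((1 - (cmod z)\<^sup>2) powr \<beta> *
               ln (2 / (1 - (cmod (\<phi> z))\<^sup>2)) * cmod (coeff0 \<phi> g z))))"
    using C C' by blast
next
  assume \<alpha>: "2 < \<alpha>"
  then have s: "0 < \<alpha> - 1" "0 < \<alpha> - 2" by simp_all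
  obtain C1 C2 where C: "C1 > 0" "C2 > 0" and cmp1: "\<And>\<beta> \<phi> u. analytic_self_map \<phi> \<Longrightarrow>
    comparable_finite C1 C2 (moment_norm \<beta> (\<alpha> - 1) \<phi> u) (composed_norm \<beta> (\<alpha> - 1) \<phi> u) \<longleftrightarrow>
       composed_norm \<beta> (\<alpha> - 1) \<phi> u < \<infinity>"
    using moment_norm_comparable[of "\<alpha> - 1"] s by auto
  obtain C3 C4 where C': "C3 > 0" "C4 > 0" and cmp0: "\<And>\<beta> \<phi> u. analytic_self_map \<phi> \<Longrightarrow>
    comparable_finite C3 C4 (moment_norm \<beta> (\<alpha> - 2) \<phi> u) (composed_norm \<beta> (\<alpha> - 2) \<phi> u) \<longleftrightarrow>
       composed_norm \<beta> (\<alpha> - 2) \<phi> u < \<infinity>"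
    using moment_norm_comparable[of "\<alpha> - 2"] s by auto
  have "bounded_zygmund_operator \<alpha> \<beta> (comp_volterra \<phi> g) \<longleftrightarrow>
      comparable_finite C1 C2 (moment_norm \<beta> (\<alpha> - 1) \<phi> (coeff1 \<phi> g))
        (composed_norm \<beta> (\<alpha> - 1) \<phi> (coeff1 \<phi> g)) \<and>
      comparable_finite C3 C4 (moment_norm \<beta> (\<alpha> - 2) \<phi> (coeff0 \<phi> g))
        (composed_norm \<beta> (\<alpha> - 2) \<phi> (coeff0 \<phi> g))"
    if *: "analytic_self_map \<phi>" "g holomorphic_on unit_disc" for \<phi> g
    using comp_volterra_bounded_iff[OF _ *, of \<alpha> \<beta>] \<alpha> cmp1[OF *(1)] cmp0[OF *(1)] by simp
  then show "\<exists>C1>0. \<exists>C2>0. \<exists>C3>0. \<exists>C4>0.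
       \<forall>\<phi> g. analytic_self_map \<phi> \<longrightarrow> g holomorphic_on unit_disc \<longrightarrow>
        (bounded_zygmund_operator \<alpha> \<beta> (comp_volterra \<phi> g) \<longleftrightarrow>
          comparable_finite C1 C2
            (SUP n::nat. ennreal ((real n + 1) powr (\<alpha> - 1)) *
               weighted_norm \<beta> (\<lambda>z. coeff1 \<phi> g z * \<phi> z ^ n))
            (SUP z\<in>unit_disc. ennreal ((1 - (cmod z)\<^sup>2) powr \<beta> /
               (1 - (cmod (\<phi> z))\<^sup>2) powr (\<alpha> - 1) * cmod (coeff1 \<phi> g z))) \<and>
          comparable_finite C3 C4
            (SUP n::nat. ennreal ((real n + 1) powr (\<alpha> - 2)) *
               weighted_norm \<beta> (\<lambda>z. coeff0 \<phi> g z * \<phi> z ^ n))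
            (SUP z\<in>unit_disc. ennreal ((1 - (cmod z)\<^sup>2) powr \<beta> /
               (1 - (cmod (\<phi> z))\<^sup>2) powr (\<alpha> - 2) * cmod (coeff0 \<phi> g z))))"
    unfolding moment_norm_pos[OF s(1), symmetric] composed_norm_pos[OF s(1), symmetric]
      moment_norm_pos[OF s(2), symmetric] composed_norm_pos[OF s(2), symmetric]
    using C C' by blast
qed

end
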